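(* Let $n\ge1$ and let $k$ be a field such that $\mathrm{char}(k)$ does not divide $n+1$. Let $X=k[x_1,\ldots,x_n]$ if $\mathrm{char}(k)=0$ and $X=k[x_1,\ldots,x_n]/(x_1^p,\ldots,x_n^p)$ if $\mathrm{char}(k)=p>0$. Regard $sl_{n+1}(k)$ as the Lie subalgebra of $\mathrm{Der}(X)$ spanned by $\{E_{i,j}\mid 1\le i\ne j\le n+1\}\cup\{E_{i,i}\mid 1\le i\le n\}$, with the $E_{i,j}\in\mathrm{Der}(X)$ as defined in the context. Then there is a Lie algebra monomorphism $$\psi: sl_{n+1}(k)\to (X\otimes sl_{n+1}(k))\rtimes\mathrm{Der}(X)$$ given by $$\psi(E_{i,n+1})=\partial/\partial x_i\quad\text{for }1\le i\le n,$$ $$\psi(E_{i,j})=1\otimes E_{i,j}+E_{i,j}\quad\text{for }1\le i,j\le n,$$ $$\psi(E_{n+1,i})=\sum_{1\le j\le n}x_j\otimes b_{i,j}+1\otimes E_{n+1,i}+E_{n+1,i}\quad\text{for }1\le i\le n,$$ where $$b_{i,j}=E_{j,i}-\delta_{i,j}E_{n+1,n+1}=E_{j,i}+\delta_{i,j}\sum_{1\le l\le n}E_{l,l}.$$ Furthermore, $sl_{n+1}(k)$ is a faithful $\psi$-self-similar Lie algebra.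
   Context: All tensor products are over $k$. The elements $E_{i,j}\in\mathrm{Der}(X)$ are $$E_{i,j}=-x_j\,\partial/\partial x_i\ (1\le i,j\le n),\qquad E_{n+1,i}=-x_i\sum_{1\le j\le n}x_j\,\partial/\partial x_j\ (1\le i\le n),$$ $$E_{i,n+1}=\partial/\partial x_i\ (1\le i\le n),\qquad E_{n+1,n+1}=\sum_{1\le i\le n}x_i\,\partial/\partial x_i.$$ When $\mathrm{char}(k)$ does not divide $n+1$, the $k$-span of $\{E_{i,j}\mid1\le i\ne j\le n+1\}\cup\{E_{i,i}-E_{i+1,i+1}\mid1\le i\le n\}$ is a Lie subalgebra isomorphic to $sl_{n+1}(k)$ (with the $E_{i,j}$ corresponding to matrix units modulo scalars), and it coincides with the span of $\{E_{i,j}\mid1\le i\ne j\le n+1\}\cup\{E_{i,i}\mid1\le i\le n\}$. For a Lie algebra $L$ over $k$, $(X\otimes L)\rtimes\mathrm{Der}\,X$ has brackets $[x\otimes a,x'\otimes a']=(xx')\otimes[a,a']$, $[\delta,x\otimes a]=\delta(x)\otimes a$, and the usual bracket on $\mathrm{Der}\,X$. In the formulas for $\psi$, terms of the form $z\otimes E$ lie in $X\otimes sl_{n+1}(k)$ and terms $E$ without tensor sign lie in $\mathrm{Der}(X)$. Given a homomorphism $\psi:L\to(X\otimes L)\rtimes\mathrm{Der}\,X$, if $\psi(a)=\sum_i z_i\otimes a_i+\delta_a$, then $L$ acts on $X$ by $a\cdot x=\delta_a(x)$ and inductively on $X^{\otimes m}$ by $a\cdot(v_1\otimes\cdots\otimes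 v_m)=\sum_i(z_iv_1)\otimes a_i\cdot(v_2\otimes\cdots\otimes v_m)+\delta_a(v_1)\otimes v_2\otimes\cdots\otimes v_m$. $L$ is $\psi$-self-similar if $\psi$ is injective and its image is contained neither in $X\otimes L$ nor in $\mathrm{Der}\,X$; it is faithful $\psi$-self-similar if moreover $\bigcap_{m\ge1}\mathrm{Ker}(L\to\mathrm{End}_k(X^{\otimes m}))=0$. *)

theory Defs
  imports Complex_Main "HOL-Library.Poly_Mapping" "HOL-Library.Product_Plus" "HOL-Library.Cardinality"
begin

section \<open>Lie algebras\<close>

locale lie_algebra = vector_space scale
  for scale :: "'k::field \<Rightarrow> 'l::ab_group_add \<Rightarrow> 'l" +
  fixes bracket :: "'l \<Rightarrow> 'l \<Rightarrow> 'l"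
  assumes bracket_add_left: "bracket (x + y) z = bracket x z + bracket y z"
    and bracket_add_right: "bracket x (y + z) = bracket x y + bracket x z"
    and bracket_scale_left: "bracket (scale c x) y = scale c (bracket x y)"
    and bracket_scale_right: "bracket x (scale c y) = scale c (bracket x y)"
    and bracket_self: "bracket x x = 0"
    and jacobi: "bracket x (bracket y z) + bracket y (bracket z x) + bracket z (bracket x y) = 0"

locale lie_algebra_hom =
  L1: lie_algebra s1 b1 + L2: lie_algebra s2 b2 + Vector_Spaces.linear s1 s2 f
  for s1 :: "'k::field \<Rightarrow> 'a::ab_group_add \<Rightarrow> 'a" and b1
    and s2 :: "'k \<Rightarrow> 'b::ab_group_add \<Rightarrow> 'b" and b2
    and f :: "'a \<Rightarrow> 'b" +
  assumes hom_bracket: "f (b1 x y) = b2 (f x) (f y)"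


section \<open>Free vector spaces and tensor relations\<close>

text \<open>The type \<^typ>\<open>'a \<Rightarrow>\<^sub>0 'k\<close> is the free vector space with basis
  \<^term>\<open>Poly_Mapping.single a 1\<close>, and \<open>free_lift s g\<close> is the linear map sending
  the basis vector of \<open>a\<close> to \<open>g a\<close>.\<close>

definition free_scale :: "'k::field \<Rightarrow> ('a \<Rightarrow>\<^sub>0 'k) \<Rightarrow> ('a \<Rightarrow>\<^sub>0 'k)"
  where "free_scale c f = Poly_Mapping.map ((*) c) f"

definition free_lift :: "('k::field \<Rightarrow> 'b::ab_group_add \<Rightarrow> 'b) \<Rightarrow> ('a \<Rightarrow> 'b) \<Rightarrow> ('a \<Rightarrow>\<^sub>0 'k) \<Rightarrow> 'b"
  where "free_lift s g f = (\<Sum>a\<in>Poly_Mapping.keys f. s (Poly_Mapping.lookup f a) (g a))"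

lemma lookup_free_scale [simp]:
  "Poly_Mapping.lookup (free_scale c f) a = c * Poly_Mapping.lookup f a"
  by (simp add: free_scale_def map.rep_eq when_def)

lemma vector_space_free_scale: "vector_space free_scale"
  by unfold_locales (auto intro!: poly_mapping_eqI simp: lookup_add algebra_simps)

interpretation free: vector_space free_scale
  by (rule vector_space_free_scale)

lemma free_scale_single [simp]:
  "free_scale c (Poly_Mapping.single a d) = Poly_Mapping.single a (c * d)"
  by (rule poly_mapping_eqI) (auto simp: lookup_single when_def)

lemma equivp_span:
  assumes "module s"
  shows "equivp (\<lambda>x y. x - y \<in> module.span s S)"
proof -
  interpret module s by fact
  show ?thesis
  proof (rule equivpI)
    show "reflp (\<lambda>x y. x - y \<in> span S)" by (rule reflpI) (simp add: span_zero)
    show "symp (\<lambda>x y. x - y \<in> span S)"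
    proof (rule sympI)
      fix x y assume "x - y \<in> span S"
      from span_neg[OF this] show "y - x \<in> span S" by simp
    qed
    show "transp (\<lambda>x y. x - y \<in> span S)"
    proof (rule transpI)
      fix x y z assume "x - y \<in> span S" "y - z \<in> span S"
      from span_add[OF this] show "x - z \<in> span S" by simp
    qed
  qed
qed

lemma free_lift_superset:
  assumes "vector_space s" "finite A" "Poly_Mapping.keys f \<subseteq> A"
  shows "free_lift s g f = (\<Sum>a\<in>A. s (Poly_Mapping.lookup f a) (g a))"
proof -
  interpret vector_space s by fact
  show ?thesis unfolding free_lift_def
    by (rule sum.mono_neutral_left) (use assms in \<open>auto simp: in_keys_iff\<close>)
qed

lemma linear_free_lift:
  assumes "vector_space s"
  shows "Vector_Spaces.linear free_scale s (free_lift s g)"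
proof -
  interpret s: vector_space s by fact
  show ?thesis
  proof (unfold Vector_Spaces.linear_iff, intro conjI allI)
    show "vector_space free_scale" "vector_space s"
      by (rule vector_space_free_scale, fact)
    fix x y :: "'c \<Rightarrow>\<^sub>0 'a" and c
    let ?A = "Poly_Mapping.keys x \<union> Poly_Mapping.keys y"
    have "free_lift s g (x + y) = (\<Sum>a\<in>?A. s (Poly_Mapping.lookup (x + y) a) (g a))"
      by (rule free_lift_superset[OF assms]) (use keys_add[of x y] in auto)
    also have "\<dots> = (\<Sum>a\<in>?A. s (Poly_Mapping.lookup x a) (g a)) + (\<Sum>a\<in>?A. s (Poly_Mapping.lookup y a) (g a))"
      by (simp add: lookup_add s.scale_left_distrib sum.distrib)
    also have "\<dots> = free_lift s g x + free_lift s g y"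
      by (simp add: free_lift_superset[OF assms, where A = ?A])
    finally show "free_lift s g (x + y) = free_lift s g x + free_lift s g y" .
    have "free_lift s g (free_scale c x)
        = (\<Sum>a\<in>Poly_Mapping.keys x. s (Poly_Mapping.lookup (free_scale c x) a) (g a))"
      by (rule free_lift_superset[OF assms]) (auto simp: in_keys_iff)
    then show "free_lift s g (free_scale c x) = s c (free_lift s g x)"
      by (simp add: free_lift_def s.scale_sum_right)
  qed
qed

lemma free_lift_single [simp]:
  assumes "vector_space s"
  shows "free_lift s g (Poly_Mapping.single a c) = s c (g a)"
proof -
  interpret vector_space s by fact
  show ?thesis by (simp add: free_lift_def)
qed

lemma free_span_singles: "f \<in> free.span (range (\<lambda>a. Poly_Mapping.single a 1))"
proof -
  have eq: "f = (\<Sum>a\<in>Poly_Mapping.keys f. free_scale (Poly_Mapping.lookup f a) (Poly_Mapping.single a 1))"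
    (is "_ = ?r")
  proof (rule poly_mapping_eqI)
    fix b
    have "Poly_Mapping.lookup ?r b
        = (\<Sum>a\<in>Poly_Mapping.keys f. if a = b then Poly_Mapping.lookup f a else 0)"
      unfolding lookup_sum by (rule sum.cong) (auto simp: lookup_single when_def)
    also have "\<dots> = Poly_Mapping.lookup f b"
      by (simp add: in_keys_iff)
    finally show "Poly_Mapping.lookup f b = Poly_Mapping.lookup ?r b" ..
  qed
  show ?thesis
    by (subst eq) (intro free.span_sum free.span_scale free.span_base, auto)
qed

lemma free_induct [case_names zero add scale single]:
  assumes "P 0" "\<And>x y. P x \<Longrightarrow> P y \<Longrightarrow> P (x + y)" "\<And>c x. P x \<Longrightarrow> P (free_scale c x)"
    "\<And>a. P (Poly_Mapping.single a 1)"
  shows "P f"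
  using free_span_singles[of f]
  by (induction rule: free.span_induct) (use assms in \<open>auto simp: free.subspace_def\<close>)

definition bilinear_rels ::
  "('k::field \<Rightarrow> 'a::ab_group_add \<Rightarrow> 'a) \<Rightarrow> ('k \<Rightarrow> 'b::ab_group_add \<Rightarrow> 'b) \<Rightarrow> ('a \<times> 'b \<Rightarrow>\<^sub>0 'k) set"
  where "bilinear_rels s1 s2 =
    {Poly_Mapping.single (x + y, b) 1 - Poly_Mapping.single (x, b) 1 - Poly_Mapping.single (y, b) 1 | x y b. True} \<union>
    {Poly_Mapping.single (x, a + b) 1 - Poly_Mapping.single (x, a) 1 - Poly_Mapping.single (x, b) 1 | x a b. True} \<union>
    {Poly_Mapping.single (s1 c x, b) 1 - Poly_Mapping.single (x, b) c | c x b. True} \<union>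
    {Poly_Mapping.single (x, s2 c b) 1 - Poly_Mapping.single (x, b) c | c x b. True}"

definition multilinear_rels ::
  "('k::field \<Rightarrow> 'a::ab_group_add \<Rightarrow> 'a) \<Rightarrow> ('a list \<Rightarrow>\<^sub>0 'k) set"
  where "multilinear_rels s =
    {Poly_Mapping.single (us @ (x + y) # vs) 1 - Poly_Mapping.single (us @ x # vs) 1
       - Poly_Mapping.single (us @ y # vs) 1 | us x y vs. True} \<union>
    {Poly_Mapping.single (us @ s c x # vs) 1 - Poly_Mapping.single (us @ x # vs) c | us c x vs. True}"


section \<open>The algebra \<open>X\<close>\<close>

text \<open>Variables are indexed by a finite type \<open>'n\<close>, so the number of variables is
  \<^term>\<open>CARD('n)\<close>, which is at least 1. A commutative ring is a module over itself, and
  \<^term>\<open>module.span (*) S\<close> is then the ideal generated by \<open>S\<close>. In characteristic 0 the ideal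
  divided out is zero, so \<open>tpoly\<close> is the polynomial ring itself.\<close>

definition pvar :: "'n \<Rightarrow> ('n \<Rightarrow>\<^sub>0 nat) \<Rightarrow>\<^sub>0 'k::field"
  where "pvar i = Poly_Mapping.single (Poly_Mapping.single i 1) 1"

definition trunc_ideal :: "(('n \<Rightarrow>\<^sub>0 nat) \<Rightarrow>\<^sub>0 'k::field) set"
  where "trunc_ideal = module.span (*) (if CHAR('k) = 0 then {} else range (\<lambda>i. pvar i ^ CHAR('k)))"

lemma module_times: "module ((*) :: 'a::comm_ring_1 \<Rightarrow> 'a \<Rightarrow> 'a)"
  by unfold_locales (auto simp: algebra_simps)

lemma
  fixes f g h :: "('n \<Rightarrow>\<^sub>0 nat) \<Rightarrow>\<^sub>0 'k::field"
  shows trunc_ideal_0: "(0 :: ('n \<Rightarrow>\<^sub>0 nat) \<Rightarrow>\<^sub>0 'k) \<in> trunc_ideal"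
    and trunc_ideal_add: "f \<in> trunc_ideal \<Longrightarrow> g \<in> trunc_ideal \<Longrightarrow> f + g \<in> trunc_ideal"
    and trunc_ideal_diff: "f \<in> trunc_ideal \<Longrightarrow> g \<in> trunc_ideal \<Longrightarrow> f - g \<in> trunc_ideal"
    and trunc_ideal_uminus: "f \<in> trunc_ideal \<Longrightarrow> - f \<in> trunc_ideal"
    and trunc_ideal_mult: "f \<in> trunc_ideal \<Longrightarrow> h * f \<in> trunc_ideal"
proof -
  interpret module "(*) :: (('n \<Rightarrow>\<^sub>0 nat) \<Rightarrow>\<^sub>0 'k) \<Rightarrow> _" by (rule module_times)
  show "(0 :: ('n \<Rightarrow>\<^sub>0 nat) \<Rightarrow>\<^sub>0 'k) \<in> trunc_ideal" "f \<in> trunc_ideal \<Longrightarrow> g \<in> trunc_ideal \<Longrightarrow> f + g \<in> trunc_ideal"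
    "f \<in> trunc_ideal \<Longrightarrow> g \<in> trunc_ideal \<Longrightarrow> f - g \<in> trunc_ideal"
    "f \<in> trunc_ideal \<Longrightarrow> - f \<in> trunc_ideal"
    "f \<in> trunc_ideal \<Longrightarrow> h * f \<in> trunc_ideal"
    by (auto simp: trunc_ideal_def intro: span_zero span_add span_diff span_neg span_scale)
qed

lemma trunc_ideal_induct [consumes 1, case_names zero add mult gen]:
  fixes f :: "('n \<Rightarrow>\<^sub>0 nat) \<Rightarrow>\<^sub>0 'k::field"
  assumes "f \<in> trunc_ideal"
    and "P 0" "\<And>x y. P x \<Longrightarrow> P y \<Longrightarrow> P (x + y)" "\<And>h x. P x \<Longrightarrow> P (h * x)"
    and "\<And>i. CHAR('k) > 0 \<Longrightarrow> P (pvar i ^ CHAR('k))"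
  shows "P f"
proof -
  interpret module "(*) :: (('n \<Rightarrow>\<^sub>0 nat) \<Rightarrow>\<^sub>0 'k) \<Rightarrow> _" by (rule module_times)
  show ?thesis using assms(1) unfolding trunc_ideal_def
    by (induction rule: span_induct) (use assms in \<open>auto simp: subspace_def split: if_splits\<close>)
qed

quotient_type (overloaded) ('n, 'k) tpoly = "('n::finite \<Rightarrow>\<^sub>0 nat) \<Rightarrow>\<^sub>0 'k::field" / "\<lambda>f g. f - g \<in> trunc_ideal"
  unfolding trunc_ideal_def by (rule equivp_span) (rule module_times)

lemma lookup_mult_0:
  fixes f g :: "('n \<Rightarrow>\<^sub>0 nat) \<Rightarrow>\<^sub>0 'k::field"
  shows "Poly_Mapping.lookup (f * g) 0 = Poly_Mapping.lookup f 0 * Poly_Mapping.lookup g 0"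
proof (induction f rule: free_induct)
  case (single a)
  show ?case
  proof (induction g rule: free_induct)
    case (single b)
    have "a + b = 0 \<longleftrightarrow> a = 0 \<and> b = 0"
      by (auto simp: poly_mapping_eq_iff lookup_add fun_eq_iff)
    then show ?case
      by (auto simp: mult_single lookup_single when_def)
  next
    case (scale c x)
    have "free_scale c x = Poly_Mapping.single 0 c * x"
      by (simp add: free_scale_def mult_map_scale_conv_mult)
    then have "Poly_Mapping.single a 1 * free_scale c x = free_scale c (Poly_Mapping.single a 1 * x)"
      by (simp add: free_scale_def mult_map_scale_conv_mult mult.left_commute)
    then show ?case using scale by simp
  qed (auto simp: lookup_add algebra_simps)
next
  case (scale c x)
  have "free_scale c x * g = free_scale c (x * g)"
    by (simp add: free_scale_def mult_map_scale_conv_mult mult.assoc)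
  then show ?case using scale by simp
qed (auto simp: lookup_add algebra_simps)

lemma lookup_0_trunc_ideal: "f \<in> trunc_ideal \<Longrightarrow> Poly_Mapping.lookup f 0 = 0"
proof (induction rule: trunc_ideal_induct)
  case (gen i)
  have "Poly_Mapping.single i (1::nat) \<noteq> 0"
    by (simp add: poly_mapping_eq_iff fun_eq_iff lookup_single when_def)
  then have "Poly_Mapping.lookup (pvar i :: ('a \<Rightarrow>\<^sub>0 nat) \<Rightarrow>\<^sub>0 'b) 0 = 0"
    by (simp add: pvar_def lookup_single when_def)
  moreover have "Poly_Mapping.lookup (h ^ m :: ('a \<Rightarrow>\<^sub>0 nat) \<Rightarrow>\<^sub>0 'b) 0 = Poly_Mapping.lookup h 0 ^ m" for h m
    by (induction m) (auto simp: lookup_mult_0)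
  ultimately show ?case using gen by simp
qed (auto simp: lookup_add lookup_mult_0)

instantiation tpoly :: (finite, field) comm_ring_1
begin

lift_definition zero_tpoly :: "('a, 'b) tpoly" is 0 .

lift_definition one_tpoly :: "('a, 'b) tpoly" is 1 .

lift_definition plus_tpoly :: "('a, 'b) tpoly \<Rightarrow> ('a, 'b) tpoly \<Rightarrow> ('a, 'b) tpoly" is "(+)"
  unfolding add_diff_add by (rule trunc_ideal_add)

lift_definition minus_tpoly :: "('a, 'b) tpoly \<Rightarrow> ('a, 'b) tpoly \<Rightarrow> ('a, 'b) tpoly" is "(-)"
proof -
  fix f g h k :: "('a \<Rightarrow>\<^sub>0 nat) \<Rightarrow>\<^sub>0 'b"
  assume "f - g \<in> trunc_ideal" "h - k \<in> trunc_ideal"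
  from trunc_ideal_diff[OF this] show "(f - h) - (g - k) \<in> trunc_ideal"
    by (simp add: algebra_simps)
qed

lift_definition uminus_tpoly :: "('a, 'b) tpoly \<Rightarrow> ('a, 'b) tpoly" is "uminus"
  unfolding minus_diff_minus by (rule trunc_ideal_uminus)

lift_definition times_tpoly :: "('a, 'b) tpoly \<Rightarrow> ('a, 'b) tpoly \<Rightarrow> ('a, 'b) tpoly" is "(*)"
proof -
  fix f g h k :: "('a \<Rightarrow>\<^sub>0 nat) \<Rightarrow>\<^sub>0 'b"
  assume "f - g \<in> trunc_ideal" "h - k \<in> trunc_ideal"
  then have "h * (f - g) + g * (h - k) \<in> trunc_ideal"
    by (intro trunc_ideal_add trunc_ideal_mult)
  then show "f * h - g * k \<in> trunc_ideal"
    by (simp add: algebra_simps)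
qed

instance
proof
  fix a b c :: "('a, 'b) tpoly"
  show "a + b + c = a + (b + c)" by transfer (simp add: trunc_ideal_0 add.assoc)
  show "a + b = b + a" by transfer (simp add: trunc_ideal_0 add.commute)
  show "0 + a = a" by transfer (simp add: trunc_ideal_0)
  show "- a + a = 0" by transfer (simp add: trunc_ideal_0)
  show "a - b = a + - b" by transfer (simp add: trunc_ideal_0)
  show "a * b * c = a * (b * c)" by transfer (simp add: trunc_ideal_0 mult.assoc)
  show "a * b = b * a" by transfer (simp add: trunc_ideal_0 mult.commute)
  show "1 * a = a" by transfer (simp add: trunc_ideal_0)
  show "(a + b) * c = a * c + b * c" by transfer (simp add: trunc_ideal_0 distrib_right)
  show "(0 :: ('a, 'b) tpoly) \<noteq> 1"
    by transfer (use lookup_0_trunc_ideal[of "- 1"] in \<open>auto simp: lookup_one\<close>)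
qed

end

lift_definition tscale :: "'k::field \<Rightarrow> ('n::finite, 'k) tpoly \<Rightarrow> ('n, 'k) tpoly" is free_scale
proof -
  fix c :: 'k and f g :: "('n \<Rightarrow>\<^sub>0 nat) \<Rightarrow>\<^sub>0 'k"
  assume "f - g \<in> trunc_ideal"
  then have "Poly_Mapping.single 0 c * (f - g) \<in> trunc_ideal" by (rule trunc_ideal_mult)
  then show "free_scale c f - free_scale c g \<in> trunc_ideal"
    by (simp add: free_scale_def mult_map_scale_conv_mult algebra_simps)
qed

interpretation tpoly: vector_space tscale
  by unfold_locales
    (transfer, simp add: free.scale_right_distrib free.scale_left_distrib trunc_ideal_0)+

lemma tscale_mult_left: "tscale c f * g = tscale c (f * g)"
  by transfer (simp add: free_scale_def mult_map_scale_conv_mult mult.assoc trunc_ideal_0)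

lemma tscale_mult_right: "f * tscale c g = tscale c (f * g)"
  by (metis mult.commute tscale_mult_left)

lift_definition tvar :: "'n \<Rightarrow> ('n::finite, 'k::field) tpoly" is pvar .


lemma tpoly_induct [case_names zero add scale one var mult]:
  fixes f :: "('n::finite, 'k::field) tpoly"
  assumes "P 0" "\<And>x y. P x \<Longrightarrow> P y \<Longrightarrow> P (x + y)" "\<And>c x. P x \<Longrightarrow> P (tscale c x)"
    "P 1" "\<And>i. P (tvar i)" "\<And>x y. P x \<Longrightarrow> P y \<Longrightarrow> P (x * y)"
  shows "P f"
proof -
  let ?P = "\<lambda>g. P (abs_tpoly g)"
  have var: "?P (pvar i)" for i using assms(5)[of i] unfolding tvar.abs_eq .
  have one: "?P 1" using assms(4) unfolding one_tpoly.abs_eq .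
  have mult: "?P (x * y)" if "?P x" "?P y" for x y
    using assms(6)[OF that] unfolding times_tpoly.abs_eq .
  have pow: "?P (Poly_Mapping.single (Poly_Mapping.single i m) 1)" for i m
  proof (induction m)
    case (Suc m)
    have "(Poly_Mapping.single (Poly_Mapping.single i (Suc m)) 1 :: ('n \<Rightarrow>\<^sub>0 nat) \<Rightarrow>\<^sub>0 'k)
        = pvar i * Poly_Mapping.single (Poly_Mapping.single i m) 1"
      by (simp add: pvar_def mult_single single_add[symmetric])
    then show ?case using mult[OF var Suc] by simp
  qed (simp add: one)
  have mono: "?P (Poly_Mapping.single (\<Sum>i\<in>A. Poly_Mapping.single i (h i)) 1)" for h and A :: "'n set"
  proof (induction A rule: infinite_finite_induct)
    case (insert i A)
    have "(Poly_Mapping.single (\<Sum>i\<in>insert i A. Poly_Mapping.single i (h i)) 1 :: ('n \<Rightarrow>\<^sub>0 nat) \<Rightarrow>\<^sub>0 'k)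
        = Poly_Mapping.single (Poly_Mapping.single i (h i)) 1
          * Poly_Mapping.single (\<Sum>i\<in>A. Poly_Mapping.single i (h i)) 1"
      using insert by (simp add: mult_single)
    then show ?case using mult[OF pow insert(3)] by simp
  qed (simp_all add: one)
  have "?P g" for g
  proof (induction g rule: free_induct)
    case (single a)
    have "a = (\<Sum>i\<in>UNIV. Poly_Mapping.single i (Poly_Mapping.lookup a i))"
      by (rule poly_mapping_eqI) (simp add: lookup_sum lookup_single when_def)
    then show ?case by (rule ssubst) (rule mono)
  next
    case zero
    show ?case using assms(1) unfolding zero_tpoly.abs_eq .
  next
    case (add x y)
    show ?case using assms(2)[OF add] unfolding plus_tpoly.abs_eq .
  next
    case (scale c x)
    show ?case using assms(3)[OF scale] unfolding tscale.abs_eq .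
  qed
  then show ?thesis
    by (induction f rule: tpoly.abs_induct)
qed


section \<open>Derivations of \<open>X\<close>\<close>

definition derivation :: "(('n::finite, 'k::field) tpoly \<Rightarrow> ('n, 'k) tpoly) \<Rightarrow> bool"
  where "derivation D \<longleftrightarrow> Vector_Spaces.linear tscale tscale D \<and> (\<forall>f g. D (f * g) = D f * g + f * D g)"

lemma derivation_iff:
  "derivation D \<longleftrightarrow> (\<forall>f g. D (f + g) = D f + D g) \<and> (\<forall>c f. D (tscale c f) = tscale c (D f))
    \<and> (\<forall>f g. D (f * g) = D f * g + f * D g)"
  by (auto simp: derivation_def Vector_Spaces.linear_iff tpoly.vector_space_axioms)

typedef (overloaded) ('n, 'k) der = "{D :: ('n::finite, 'k::field) tpoly \<Rightarrow> ('n, 'k) tpoly. derivation D}"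
  morphisms der_apply Abs_der
  by (rule exI[of _ "\<lambda>_. 0"]) (simp add: derivation_iff)

setup_lifting type_definition_der

lemma
  shows der_apply_add: "der_apply D (f + g) = der_apply D f + der_apply D g"
    and der_apply_scale: "der_apply D (tscale c f) = tscale c (der_apply D f)"
    and der_apply_mult: "der_apply D (f * g) = der_apply D f * g + f * der_apply D g"
  using der_apply[of D] by (auto simp: derivation_iff)

lemma der_apply_0: "der_apply D 0 = 0"
  using der_apply_add[of D 0 0] by simp

lemma der_apply_1: "der_apply D 1 = 0"
  using der_apply_mult[of D 1 1] by simp

lemma der_apply_diff: "der_apply D (f - g) = der_apply D f - der_apply D g"
  by (metis add_diff_cancel der_apply_add diff_add_cancel)

lemma der_apply_uminus: "der_apply D (- f) = - der_apply D f"
  using der_apply_diff[of D 0 f] by (simp add: der_apply_0)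

lemma der_apply_sum: "der_apply D (sum f A) = (\<Sum>a\<in>A. der_apply D (f a))"
  by (induction A rule: infinite_finite_induct) (simp_all add: der_apply_0 der_apply_add)

lemma der_eqI: "(\<And>f. der_apply D f = der_apply E f) \<Longrightarrow> D = E"
  by (metis der_apply_inject ext)

lemma der_eqI_var:
  assumes "\<And>i. der_apply D (tvar i) = der_apply E (tvar i)"
  shows "D = E"
proof (rule der_eqI)
  show "der_apply D f = der_apply E f" for f
    by (induction f rule: tpoly_induct)
      (simp_all add: assms der_apply_0 der_apply_1 der_apply_add der_apply_scale der_apply_mult)
qed

instantiation der :: (finite, field) ab_group_add
begin

lift_definition zero_der :: "('a, 'b) der" is "\<lambda>_. 0"
  by (simp add: derivation_iff)

lift_definition plus_der :: "('a, 'b) der \<Rightarrow> ('a, 'b) der \<Rightarrow> ('a, 'b) der" is "\<lambda>D E f. D f + E f"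
  by (simp add: derivation_iff algebra_simps)

lift_definition minus_der :: "('a, 'b) der \<Rightarrow> ('a, 'b) der \<Rightarrow> ('a, 'b) der" is "\<lambda>D E f. D f - E f"
  by (simp add: derivation_iff algebra_simps)

lift_definition uminus_der :: "('a, 'b) der \<Rightarrow> ('a, 'b) der" is "\<lambda>D f. - D f"
  by (simp add: derivation_iff algebra_simps)

instance
  by standard (transfer, simp add: fun_eq_iff algebra_simps)+

end

lift_definition der_scale :: "'k::field \<Rightarrow> ('n::finite, 'k) der \<Rightarrow> ('n, 'k) der" is "\<lambda>c D f. tscale c (D f)"
  by (simp add: derivation_iff tscale_mult_left tscale_mult_right algebra_simps)

definition der_mult :: "('n::finite, 'k::field) tpoly \<Rightarrow> ('n, 'k) der \<Rightarrow> ('n, 'k) der"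
  where "der_mult h D = Abs_der (\<lambda>f. h * der_apply D f)"

lift_definition der_bracket :: "('n::finite, 'k::field) der \<Rightarrow> ('n, 'k) der \<Rightarrow> ('n, 'k) der"
  is "\<lambda>D E f. D (E f) - E (D f)"
  by (simp add: derivation_iff algebra_simps)

lemma der_apply_zero_der [simp]: "der_apply 0 f = 0"
  and der_apply_plus_der [simp]: "der_apply (D + E) f = der_apply D f + der_apply E f"
  and der_apply_minus_der [simp]: "der_apply (D - E) f = der_apply D f - der_apply E f"
  and der_apply_uminus_der [simp]: "der_apply (- D) f = - der_apply D f"
  and der_apply_der_scale [simp]: "der_apply (der_scale c D) f = tscale c (der_apply D f)"
  and der_apply_der_bracket [simp]: "der_apply (der_bracket D E) f = der_apply D (der_apply E f) - der_apply E (der_apply D f)"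
  by (simp_all add: zero_der.rep_eq plus_der.rep_eq minus_der.rep_eq uminus_der.rep_eq
      der_scale.rep_eq der_bracket.rep_eq)

lemma der_apply_der_mult [simp]: "der_apply (der_mult h D) f = h * der_apply D f"
proof -
  have "derivation (\<lambda>f. h * der_apply D f)"
    by (simp add: derivation_iff der_apply_add der_apply_scale der_apply_mult tscale_mult_right algebra_simps)
  then show ?thesis by (simp add: der_mult_def Abs_der_inverse)
qed

lemma der_apply_sum_der [simp]: "der_apply (sum D A) f = (\<Sum>a\<in>A. der_apply (D a) f)"
  by (induction A rule: infinite_finite_induct) simp_all

interpretation der: lie_algebra der_scale der_bracket
  by unfold_locales (rule der_eqI, simp add: der_apply_add der_apply_scale der_apply_diff algebra_simps)+

text \<open>The truncated subtraction of exponents is harmless: the coefficient is 0 when \<open>x\<^sub>i\<close> does not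
  occur in the monomial.\<close>

definition pdiff :: "'n \<Rightarrow> (('n \<Rightarrow>\<^sub>0 nat) \<Rightarrow>\<^sub>0 'k::field) \<Rightarrow> (('n \<Rightarrow>\<^sub>0 nat) \<Rightarrow>\<^sub>0 'k)"
  where "pdiff i = free_lift free_scale
    (\<lambda>m. Poly_Mapping.single (m - Poly_Mapping.single i 1) (of_nat (Poly_Mapping.lookup m i)))"

lemma linear_pdiff: "Vector_Spaces.linear free_scale free_scale (pdiff i)"
  unfolding pdiff_def by (rule linear_free_lift) (rule vector_space_free_scale)

lemma pdiff_add: "pdiff i (f + g) = pdiff i f + pdiff i g"
  and pdiff_scale: "pdiff i (free_scale c f) = free_scale c (pdiff i f)"
  and pdiff_zero: "pdiff i 0 = 0"
  and pdiff_diff: "pdiff i (f - g) = pdiff i f - pdiff i g"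
proof -
  interpret Vector_Spaces.linear free_scale free_scale "pdiff i" by (rule linear_pdiff)
  show "pdiff i (f + g) = pdiff i f + pdiff i g" "pdiff i (free_scale c f) = free_scale c (pdiff i f)"
    "pdiff i 0 = 0" "pdiff i (f - g) = pdiff i f - pdiff i g"
    by (fact add scale zero diff)+
qed

lemma pdiff_single: "pdiff i (Poly_Mapping.single m c) =
    Poly_Mapping.single (m - Poly_Mapping.single i 1) (c * of_nat (Poly_Mapping.lookup m i))"
  by (simp add: pdiff_def vector_space_free_scale)

lemma free_scale_mult_left: "free_scale c f * g = free_scale c (f * g)"
  for f g :: "('n \<Rightarrow>\<^sub>0 nat) \<Rightarrow>\<^sub>0 'k::field"
  by (simp add: free_scale_def mult_map_scale_conv_mult mult.assoc)

lemma free_scale_mult_right: "f * free_scale c g = free_scale c (f * g)"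
  for f g :: "('n \<Rightarrow>\<^sub>0 nat) \<Rightarrow>\<^sub>0 'k::field"
  by (metis mult.commute free_scale_mult_left)

lemma pdiff_mult: "pdiff i (f * g) = pdiff i f * g + f * pdiff i g"
proof (induction f rule: free_induct)
  case (single a)
  show ?case
  proof (induction g rule: free_induct)
    case (single b)
    let ?e = "Poly_Mapping.single i (1::nat)"
    have shift: "Poly_Mapping.single (a - ?e + b) (of_nat (Poly_Mapping.lookup a i))
        = (Poly_Mapping.single (a + b - ?e) (of_nat (Poly_Mapping.lookup a i)) :: _ \<Rightarrow>\<^sub>0 'b)"
      for a b :: "'a \<Rightarrow>\<^sub>0 nat"
    proof (cases "Poly_Mapping.lookup a i = 0")
      case False
      then have "a - ?e + b = a + b - ?e"
        by (intro poly_mapping_eqI) (auto simp: lookup_add lookup_minus lookup_single when_def)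
      then show ?thesis by (rule arg_cong)
    qed simp
    show ?case
      using shift[of a b] shift[of b a]
      by (simp add: pdiff_single mult_single lookup_add single_add add.commute)
  qed (simp_all add: pdiff_zero pdiff_add pdiff_scale free_scale_mult_left free_scale_mult_right free.scale_right_distrib algebra_simps)
qed (simp_all add: pdiff_zero pdiff_add pdiff_scale free_scale_mult_left free_scale_mult_right free.scale_right_distrib algebra_simps)

lemma pdiff_power: "pdiff i (f ^ m) = of_nat m * f ^ (m - 1) * pdiff i f"
proof (induction m)
  case 0
  have "pdiff i (Poly_Mapping.single 0 1) = 0"
    by (simp only: pdiff_single) simp
  then show ?case by simp
next
  case (Suc m)
  then show ?case by (cases m) (auto simp: pdiff_mult algebra_simps)
qed

lemma pdiff_trunc_ideal:
  fixes f :: "('n \<Rightarrow>\<^sub>0 nat) \<Rightarrow>\<^sub>0 'k::field"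
  assumes "f \<in> trunc_ideal"
  shows "pdiff i f \<in> trunc_ideal"
proof -
  from assms have "f \<in> trunc_ideal \<and> pdiff i f \<in> trunc_ideal"
  proof (induction rule: trunc_ideal_induct)
    case (mult h x)
    then show ?case
      by (auto simp: pdiff_mult intro: trunc_ideal_add trunc_ideal_mult)
  next
    case (gen j)
    have "of_nat CHAR('k) = (0 :: ('n \<Rightarrow>\<^sub>0 nat) \<Rightarrow>\<^sub>0 'k)"
      unfolding single_of_nat[symmetric] of_nat_CHAR single_zero ..
    moreover have "(pvar j ^ CHAR('k) :: ('n \<Rightarrow>\<^sub>0 nat) \<Rightarrow>\<^sub>0 'k) \<in> trunc_ideal"
      unfolding trunc_ideal_def using gen
      by (auto intro!: module.span_base[OF module_times])
    ultimately show ?case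
      by (simp add: pdiff_power trunc_ideal_0)
  qed (auto simp: trunc_ideal_0 pdiff_zero pdiff_add intro: trunc_ideal_add)
  then show ?thesis ..
qed

lift_definition tdiff :: "'n \<Rightarrow> ('n::finite, 'k::field) tpoly \<Rightarrow> ('n, 'k) tpoly" is pdiff
  unfolding pdiff_diff[symmetric] by (rule pdiff_trunc_ideal)

lift_definition der_partial :: "'n \<Rightarrow> ('n::finite, 'k::field) der" is tdiff
  unfolding derivation_iff
  by (intro conjI allI; transfer; simp add: pdiff_add pdiff_scale pdiff_mult trunc_ideal_0)

lemma der_apply_partial: "der_apply (der_partial i) f = tdiff i f"
  by (simp add: der_partial.rep_eq)

lemma der_partial_var [simp]: "der_apply (der_partial i) (tvar j) = (if i = j then 1 else 0)"
proof -
  have "tdiff i (tvar j) = (if i = j then 1 else (0 :: ('a, 'b) tpoly))"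
  proof transfer
    fix i j :: 'a
    have "pdiff i (pvar j) = (if i = j then 1 else (0 :: ('a \<Rightarrow>\<^sub>0 nat) \<Rightarrow>\<^sub>0 'b))"
      by (simp add: pvar_def pdiff_single lookup_single when_def)
    then show "pdiff i (pvar j) - (if i = j then 1 else (0 :: ('a \<Rightarrow>\<^sub>0 nat) \<Rightarrow>\<^sub>0 'b)) \<in> trunc_ideal"
      by (simp add: trunc_ideal_0)
  qed
  then show ?thesis by (simp add: der_apply_partial)
qed


section \<open>The Lie algebra \<open>sl\<^sub>n\<^sub>+\<^sub>1\<close>\<close>

text \<open>The index set \<open>{1, \<dots>, n + 1}\<close> is \<^typ>\<open>'n option\<close>, where \<^const>\<open>None\<close> plays the role
  of \<open>n + 1\<close>.\<close>

fun der_E :: "'n option \<Rightarrow> 'n option \<Rightarrow> ('n::finite, 'k::field) der" where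
  "der_E (Some i) (Some j) = - der_mult (tvar j) (der_partial i)"
| "der_E None (Some i) = - der_mult (tvar i) (\<Sum>j\<in>UNIV. der_mult (tvar j) (der_partial j))"
| "der_E (Some i) None = der_partial i"
| "der_E None None = (\<Sum>i\<in>UNIV. der_mult (tvar i) (der_partial i))"

definition sl_gens :: "('n::finite, 'k::field) der set"
  where "sl_gens = {der_E i j | i j. i \<noteq> j} \<union> {der_E (Some i) (Some i) | i. True}"

typedef (overloaded) ('n, 'k) sl = "der.span (sl_gens :: ('n::finite, 'k::field) der set)"
  morphisms sl_der Abs_sl
  using der.span_zero by blast

setup_lifting type_definition_sl

lemma der_E_None_None: "der_E None None = - (\<Sum>i\<in>UNIV. der_E (Some i) (Some i))"
  by (simp add: sum_negf)

lemma der_E_in_span: "der_E i j \<in> der.span sl_gens"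
proof (cases "i = None \<and> j = None")
  case True
  have "- (\<Sum>i\<in>UNIV. der_E (Some i) (Some i)) \<in> der.span sl_gens"
    by (intro der.span_neg der.span_sum der.span_base) (auto simp: sl_gens_def)
  then show ?thesis using True der_E_None_None by metis
next
  case False
  then have "der_E i j \<in> sl_gens" by (cases i; cases j) (auto simp: sl_gens_def simp del: der_E.simps)
  then show ?thesis by (rule der.span_base)
qed

lemma der_E_apply_var:
  "der_apply (der_E i j) (tvar m) =
    - (case j of None \<Rightarrow> - 1 | Some j' \<Rightarrow> tvar j') * (case i of None \<Rightarrow> tvar m | Some i' \<Rightarrow> if i' = m then 1 else 0)"
  by (cases i; cases j) (auto simp: if_distrib[of "(*) _"] cong: if_cong)

lemma bracket_der_E:
  "der_bracket (der_E i j) (der_E k l) = (if j = k then der_E i l else 0) - (if i = l then der_E k j else 0)"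
  by (rule der_eqI_var)
    (auto simp: der_E_apply_var der_apply_mult der_apply_0 der_apply_1 der_apply_uminus simp del: der_E.simps
      split: option.splits)

lemma sl_closed:
  assumes "D \<in> der.span sl_gens" "D' \<in> der.span sl_gens"
  shows "der_bracket D D' \<in> der.span sl_gens"
  using assms(1)
proof (induction rule: der.span_induct)
  case base
  then show ?case
    by (auto simp: der.subspace_def der.bracket_add_left der.bracket_scale_left
        intro: der.span_add der.span_scale) (metis der.bracket_scale_left der.scale_zero_left der.span_zero)
next
  case (step D)
  then obtain i j where D: "D = der_E i j" by (auto simp: sl_gens_def simp del: der_E.simps)
  show ?case using assms(2)
  proof (induction rule: der.span_induct)
    case base
    then show ?case
      by (auto simp: der.subspace_def der.bracket_add_right der.bracket_scale_right
          intro: der.span_add der.span_scale) (metis der.bracket_scale_right der.scale_zero_left der.span_zero)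
  next
    case (step D')
    then obtain k l where "D' = der_E k l" by (auto simp: sl_gens_def simp del: der_E.simps)
    then show ?case
      by (auto simp: D bracket_der_E simp del: der_E.simps intro: der.span_zero der_E_in_span der.span_neg der.span_diff)
  qed
qed

lemma sl_eqI: "sl_der a = sl_der b \<Longrightarrow> a = b"
  by (simp add: sl_der_inject)

instantiation sl :: (finite, field) ab_group_add
begin

lift_definition zero_sl :: "('a, 'b) sl" is 0 by (rule der.span_zero)

lift_definition plus_sl :: "('a, 'b) sl \<Rightarrow> ('a, 'b) sl \<Rightarrow> ('a, 'b) sl" is "(+)" by (rule der.span_add)

lift_definition minus_sl :: "('a, 'b) sl \<Rightarrow> ('a, 'b) sl \<Rightarrow> ('a, 'b) sl" is "(-)" by (rule der.span_diff)

lift_definition uminus_sl :: "('a, 'b) sl \<Rightarrow> ('a, 'b) sl" is uminus by (rule der.span_neg)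

instance
  by standard (rule sl_eqI, simp add: zero_sl.rep_eq plus_sl.rep_eq minus_sl.rep_eq uminus_sl.rep_eq
      add.assoc add.commute)+

end

lift_definition sl_scale :: "'k::field \<Rightarrow> ('n::finite, 'k) sl \<Rightarrow> ('n, 'k) sl" is der_scale
  by (rule der.span_scale)

lift_definition sl_bracket :: "('n::finite, 'k::field) sl \<Rightarrow> ('n, 'k) sl \<Rightarrow> ('n, 'k) sl" is der_bracket
  by (rule sl_closed)

lift_definition sl_E :: "'n option \<Rightarrow> 'n option \<Rightarrow> ('n::finite, 'k::field) sl" is der_E
  by (rule der_E_in_span)

definition sl_b :: "'n \<Rightarrow> 'n \<Rightarrow> ('n::finite, 'k::field) sl"
  where "sl_b i j = sl_E (Some j) (Some i) - (if i = j then sl_E None None else 0)"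

lemmas sl_rep_eqs = zero_sl.rep_eq plus_sl.rep_eq minus_sl.rep_eq uminus_sl.rep_eq
  sl_scale.rep_eq sl_bracket.rep_eq sl_E.rep_eq

interpretation sl: lie_algebra sl_scale sl_bracket
  by unfold_locales (rule sl_eqI, simp add: sl_rep_eqs der.scale_right_distrib der.scale_left_distrib
      der.bracket_add_left der.bracket_add_right der.bracket_scale_left der.bracket_scale_right
      der.bracket_self der.jacobi)+


section \<open>The semidirect product \<open>(X \<otimes> sl\<^sub>n\<^sub>+\<^sub>1) \<rtimes> Der X\<close>\<close>

quotient_type (overloaded) ('n, 'k) xsl =
  "(('n::finite, 'k::field) tpoly \<times> ('n, 'k) sl) \<Rightarrow>\<^sub>0 'k"
  / "\<lambda>t u. t - u \<in> module.span free_scale (bilinear_rels tscale sl_scale)"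
  by (rule equivp_span) (rule free.module_axioms)

definition tensor :: "('n::finite, 'k::field) tpoly \<Rightarrow> ('n, 'k) sl \<Rightarrow> ('n, 'k) xsl" (infixl \<open>\<otimes>\<close> 70)
  where "x \<otimes> a = abs_xsl (Poly_Mapping.single (x, a) 1)"

instantiation xsl :: (finite, field) ab_group_add
begin

lift_definition zero_xsl :: "('a, 'b) xsl" is 0 .

lift_definition plus_xsl :: "('a, 'b) xsl \<Rightarrow> ('a, 'b) xsl \<Rightarrow> ('a, 'b) xsl" is "(+)"
  unfolding add_diff_add by (rule free.span_add)

lift_definition uminus_xsl :: "('a, 'b) xsl \<Rightarrow> ('a, 'b) xsl" is uminus
  unfolding minus_diff_minus by (rule free.span_neg)

definition minus_xsl :: "('a, 'b) xsl \<Rightarrow> ('a, 'b) xsl \<Rightarrow> ('a, 'b) xsl"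
  where "minus_xsl t u = t + - u"

instance
proof
  fix t u v :: "('a, 'b) xsl"
  show "t + u + v = t + (u + v)" by transfer (simp add: free.span_zero add.assoc)
  show "t + u = u + t" by transfer (simp add: free.span_zero add.commute)
  show "0 + t = t" by transfer (simp add: free.span_zero)
  show "- t + t = 0" by transfer (simp add: free.span_zero)
  show "t - u = t + - u" by (rule minus_xsl_def)
qed

end

lift_definition xsl_scale :: "'k::field \<Rightarrow> ('n::finite, 'k) xsl \<Rightarrow> ('n, 'k) xsl" is free_scale
  unfolding free.scale_right_diff_distrib[symmetric] by (rule free.span_scale)

interpretation xsl: vector_space xsl_scale
  by unfold_locales
    (transfer, simp add: free.scale_right_distrib free.scale_left_distrib free.span_zero)+

text \<open>\<open>xsl_lift s f\<close> is the linear map induced by a bilinear \<open>f\<close> (lemma \<open>xsl_lift_tensor\<close> below);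
  for other \<open>f\<close> its value depends on the choice of representatives.\<close>

definition xsl_lift :: "('k::field \<Rightarrow> 'b::ab_group_add \<Rightarrow> 'b)
    \<Rightarrow> (('n::finite, 'k) tpoly \<Rightarrow> ('n, 'k) sl \<Rightarrow> 'b) \<Rightarrow> ('n, 'k) xsl \<Rightarrow> 'b"
  where "xsl_lift s f t = free_lift s (\<lambda>(x, a). f x a) (rep_xsl t)"

lemma xsl_induct [case_names zero add scale tensor]:
  fixes t :: "('n::finite, 'k::field) xsl"
  assumes "P 0" "\<And>t u. P t \<Longrightarrow> P u \<Longrightarrow> P (t + u)" "\<And>c t. P t \<Longrightarrow> P (xsl_scale c t)" "\<And>x a. P (x \<otimes> a)"
  shows "P t"
proof -
  have "P (abs_xsl r)" for r
  proof (induction r rule: free_induct)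
    case zero
    show ?case using assms(1) unfolding zero_xsl.abs_eq .
  next
    case (add x y)
    show ?case using assms(2)[OF add] unfolding plus_xsl.abs_eq .
  next
    case (scale c x)
    show ?case using assms(3)[OF scale] unfolding xsl_scale.abs_eq .
  next
    case (single p)
    show ?case using assms(4)[of "fst p" "snd p"] by (simp add: tensor_def)
  qed
  then show ?thesis by (induction t rule: xsl.abs_induct)
qed

lemma
  shows tensor_add_left: "(x + y) \<otimes> a = x \<otimes> a + y \<otimes> a"
    and tensor_add_right: "x \<otimes> (a + b) = x \<otimes> a + x \<otimes> b"
    and tensor_scale_left: "tscale c x \<otimes> a = xsl_scale c (x \<otimes> a)"
    and tensor_scale_right: "x \<otimes> sl_scale c a = xsl_scale c (x \<otimes> a)"
proof -
  show "(x + y) \<otimes> a = x \<otimes> a + y \<otimes> a"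
    unfolding tensor_def plus_xsl.abs_eq xsl.abs_eq_iff diff_diff_eq[symmetric]
    by (rule free.span_base) (unfold bilinear_rels_def, blast)
  show "x \<otimes> (a + b) = x \<otimes> a + x \<otimes> b"
    unfolding tensor_def plus_xsl.abs_eq xsl.abs_eq_iff diff_diff_eq[symmetric]
    by (rule free.span_base) (unfold bilinear_rels_def, blast)
  show "tscale c x \<otimes> a = xsl_scale c (x \<otimes> a)"
    unfolding tensor_def xsl_scale.abs_eq xsl.abs_eq_iff free_scale_single mult_1_right
    by (rule free.span_base) (unfold bilinear_rels_def, blast)
  show "x \<otimes> sl_scale c a = xsl_scale c (x \<otimes> a)"
    unfolding tensor_def xsl_scale.abs_eq xsl.abs_eq_iff free_scale_single mult_1_right
    by (rule free.span_base) (unfold bilinear_rels_def, blast)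
qed

lemma tensor_zero_left: "0 \<otimes> a = 0"
  using tensor_add_left[of 0 0 a] by simp

lemma tensor_zero_right: "x \<otimes> 0 = 0"
  using tensor_add_right[of x 0 0] by simp

lemma tensor_minus_right: "x \<otimes> (- a) = - (x \<otimes> a)"
  using tensor_add_right[of x a "- a"] by (simp add: tensor_zero_right eq_neg_iff_add_eq_0 add.commute)

lemma tensor_diff_left: "(x - y) \<otimes> a = x \<otimes> a - y \<otimes> a"
  using tensor_add_left[of "x - y" y a] by simp

context
  fixes s :: "'k::field \<Rightarrow> 'b::ab_group_add \<Rightarrow> 'b"
    and f :: "('n::finite, 'k) tpoly \<Rightarrow> ('n, 'k) sl \<Rightarrow> 'b"
  assumes vs: "vector_space s"
    and f: "\<And>x y a. f (x + y) a = f x a + f y a" "\<And>x a b. f x (a + b) = f x a + f x b"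
      "\<And>c x a. f (tscale c x) a = s c (f x a)" "\<And>c x a. f x (sl_scale c a) = s c (f x a)"
begin

lemma xsl_lift_abs: "xsl_lift s f (abs_xsl r) = free_lift s (\<lambda>(x, a). f x a) r"
proof -
  let ?g = "free_lift s (\<lambda>(x, a). f x a)"
  interpret s: vector_space s by (rule vs)
  interpret Vector_Spaces.linear free_scale s ?g by (rule linear_free_lift[OF vs])
  have "?g u = 0" if "u \<in> free.span (bilinear_rels tscale sl_scale)" for u
    using that
  proof (induction rule: free.span_induct)
    case base
    show ?case by (auto simp: free.subspace_def add scale zero)
  next
    case (step u)
    then show ?case by (auto simp: bilinear_rels_def diff vs f)
  qed
  moreover have "rep_xsl (abs_xsl r) - r \<in> free.span (bilinear_rels tscale sl_scale)"
    by (rule Quotient3_rep_abs[OF Quotient3_xsl]) (simp add: free.span_zero)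
  ultimately have "?g (rep_xsl (abs_xsl r) - r) = 0" by blast
  then show ?thesis by (simp add: xsl_lift_def diff)
qed

lemma xsl_lift_add: "xsl_lift s f (t + u) = xsl_lift s f t + xsl_lift s f u"
proof (induction t rule: xsl.abs_induct)
  case (1 t)
  show ?case
  proof (induction u rule: xsl.abs_induct)
    case (1 u)
    show ?case using linear_free_lift[OF vs, of "\<lambda>(x, a). f x a"]
      by (simp add: plus_xsl.abs_eq xsl_lift_abs Vector_Spaces.linear_iff)
  qed
qed

lemma xsl_lift_scale: "xsl_lift s f (xsl_scale c t) = s c (xsl_lift s f t)"
proof (induction t rule: xsl.abs_induct)
  case (1 t)
  show ?case using linear_free_lift[OF vs, of "\<lambda>(x, a). f x a"]
    by (simp add: xsl_scale.abs_eq xsl_lift_abs Vector_Spaces.linear_iff)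
qed

lemma linear_xsl_lift: "Vector_Spaces.linear xsl_scale s (xsl_lift s f)"
  by (simp add: Vector_Spaces.linear_iff xsl.vector_space_axioms vs xsl_lift_add xsl_lift_scale)

lemma xsl_lift_tensor: "xsl_lift s f (x \<otimes> a) = f x a"
  using vector_space.vector_space_assms(4)[OF vs] by (simp add: tensor_def xsl_lift_abs vs)

end


definition xsl_bracket :: "('n::finite, 'k::field) xsl \<Rightarrow> ('n, 'k) xsl \<Rightarrow> ('n, 'k) xsl"
  where "xsl_bracket t u =
    xsl_lift xsl_scale (\<lambda>x a. xsl_lift xsl_scale (\<lambda>y b. (x * y) \<otimes> sl_bracket a b) u) t"

definition der_act :: "('n::finite, 'k::field) der \<Rightarrow> ('n, 'k) xsl \<Rightarrow> ('n, 'k) xsl"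
  where "der_act D t = xsl_lift xsl_scale (\<lambda>x a. der_apply D x \<otimes> a) t"

text \<open>Elements of \<open>(X \<otimes> sl\<^sub>n\<^sub>+\<^sub>1) \<rtimes> Der X\<close> are pairs: \<open>(t, D)\<close> stands for \<open>t + D\<close>.\<close>

type_synonym ('n, 'k) semi = "('n, 'k) xsl \<times> ('n, 'k) der"

definition semi_scale :: "'k::field \<Rightarrow> ('n::finite, 'k) semi \<Rightarrow> ('n, 'k) semi"
  where "semi_scale c p = (xsl_scale c (fst p), der_scale c (snd p))"

definition semi_bracket :: "('n::finite, 'k::field) semi \<Rightarrow> ('n, 'k) semi \<Rightarrow> ('n, 'k) semi"
  where "semi_bracket p q =
    (xsl_bracket (fst p) (fst q) + der_act (snd p) (fst q) - der_act (snd q) (fst p),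
     der_bracket (snd p) (snd q))"

lemmas tensor_simps = tensor_add_left tensor_add_right tensor_scale_left tensor_scale_right

lemma
  shows der_act_add: "der_act D (t + u) = der_act D t + der_act D u"
    and der_act_scale: "der_act D (xsl_scale c t) = xsl_scale c (der_act D t)"
    and der_act_tensor: "der_act D (x \<otimes> a) = der_apply D x \<otimes> a"
  unfolding der_act_def
  by (rule xsl_lift_add xsl_lift_scale xsl_lift_tensor;
      simp add: xsl.vector_space_axioms der_apply_add der_apply_scale tensor_simps)+

lemma xsl_lift_plus_fun:
  assumes "vector_space s"
  shows "xsl_lift s (\<lambda>x a. f x a + g x a) t = xsl_lift s f t + xsl_lift s g t"
proof -
  interpret vector_space s by fact
  show ?thesis
    by (simp add: xsl_lift_def free_lift_def case_prod_unfold scale_right_distrib sum.distrib)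
qed

lemma xsl_lift_scale_fun:
  assumes "vector_space s"
  shows "xsl_lift s (\<lambda>x a. s c (f x a)) t = s c (xsl_lift s f t)"
proof -
  interpret vector_space s by fact
  show ?thesis
    by (simp add: xsl_lift_def free_lift_def case_prod_unfold scale_sum_right mult.commute)
qed

lemma
  fixes t u v :: "('n::finite, 'k::field) xsl" and x y :: "('n, 'k) tpoly" and a b :: "('n, 'k) sl"
  shows xsl_bracket_add_left: "xsl_bracket (t + u) v = xsl_bracket t v + xsl_bracket u v"
    and xsl_bracket_add_right: "xsl_bracket t (u + v) = xsl_bracket t u + xsl_bracket t v"
    and xsl_bracket_scale_left: "xsl_bracket (xsl_scale c t) u = xsl_scale c (xsl_bracket t u)"
    and xsl_bracket_scale_right: "xsl_bracket t (xsl_scale c u) = xsl_scale c (xsl_bracket t u)"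
    and xsl_bracket_tensor: "xsl_bracket (x \<otimes> a) (y \<otimes> b) = (x * y) \<otimes> sl_bracket a b"
proof -
  note vs = xsl.vector_space_axioms
  let ?f = "\<lambda>u x a. xsl_lift xsl_scale (\<lambda>y b. (x * y) \<otimes> sl_bracket a b) u :: ('n, 'k) xsl"
  have 1: "?f (u + v) x a = ?f u x a + ?f v x a" "?f (xsl_scale c u) x a = xsl_scale c (?f u x a)"
    "?f (y \<otimes> b) x a = (x * y) \<otimes> sl_bracket a b" for u v x a c y b
    by (rule xsl_lift_add xsl_lift_scale xsl_lift_tensor;
      simp add: vs distrib_left tscale_mult_right tensor_simps sl.bracket_add_right sl.bracket_scale_right)+
  have 2: "?f u (x + y) a = ?f u x a + ?f u y a" "?f u x (a + b) = ?f u x a + ?f u x b"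
    "?f u (tscale c x) a = xsl_scale c (?f u x a)" "?f u x (sl_scale c a) = xsl_scale c (?f u x a)"
    for u x y a b c
    by (simp_all add: distrib_right tscale_mult_left tensor_simps sl.bracket_add_left sl.bracket_scale_left
        xsl_lift_plus_fun[OF vs] xsl_lift_scale_fun[OF vs])
  show "xsl_bracket (t + u) v = xsl_bracket t v + xsl_bracket u v"
    "xsl_bracket (xsl_scale c t) u = xsl_scale c (xsl_bracket t u)"
    unfolding xsl_bracket_def by (rule xsl_lift_add[OF vs 2] xsl_lift_scale[OF vs 2])+
  show "xsl_bracket (x \<otimes> a) (y \<otimes> b) = (x * y) \<otimes> sl_bracket a b"
    unfolding xsl_bracket_def by (rule trans[OF xsl_lift_tensor[OF vs 2] 1(3)])
  show "xsl_bracket t (u + v) = xsl_bracket t u + xsl_bracket t v"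
    "xsl_bracket t (xsl_scale c u) = xsl_scale c (xsl_bracket t u)"
    unfolding xsl_bracket_def by (simp_all only: 1 xsl_lift_plus_fun[OF vs] xsl_lift_scale_fun[OF vs])
qed

lemma
  shows xsl_bracket_zero_left: "xsl_bracket 0 u = 0"
    and xsl_bracket_zero_right: "xsl_bracket u 0 = 0"
    and der_act_zero: "der_act D 0 = 0"
  using xsl_bracket_add_left[of 0 0 u] xsl_bracket_add_right[of u 0 0] der_act_add[of D 0 0]
  by simp_all

lemma
  shows xsl_bracket_minus_left: "xsl_bracket (- t) u = - xsl_bracket t u"
    and xsl_bracket_minus_right: "xsl_bracket u (- t) = - xsl_bracket u t"
    and der_act_minus: "der_act D (- t) = - der_act D t"
  using xsl_bracket_add_left[of t "- t" u] xsl_bracket_add_right[of u t "- t"] der_act_add[of D t "- t"]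
  by (simp_all add: xsl_bracket_zero_left xsl_bracket_zero_right der_act_zero eq_neg_iff_add_eq_0 add.commute)

lemma
  shows xsl_bracket_diff_left: "xsl_bracket (t - v) u = xsl_bracket t u - xsl_bracket v u"
    and xsl_bracket_diff_right: "xsl_bracket u (t - v) = xsl_bracket u t - xsl_bracket u v"
    and der_act_diff: "der_act D (t - v) = der_act D t - der_act D v"
  by (simp_all only: diff_conv_add_uminus xsl_bracket_add_left xsl_bracket_add_right der_act_add
      xsl_bracket_minus_left xsl_bracket_minus_right der_act_minus)

lemma
  shows der_act_add_der: "der_act (D + D') t = der_act D t + der_act D' t"
    and der_act_scale_der: "der_act (der_scale c D) t = xsl_scale c (der_act D t)"
    and der_act_bracket_der: "der_act (der_bracket D D') t = der_act D (der_act D' t) - der_act D' (der_act D t)"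
  by (induction t rule: xsl_induct;
      simp add: der_act_zero der_act_add der_act_scale der_act_tensor tensor_simps tensor_diff_left
        xsl.scale_right_distrib xsl.scale_right_diff_distrib mult.commute)+

lemma der_act_xsl_bracket:
  "der_act D (xsl_bracket t u) = xsl_bracket (der_act D t) u + xsl_bracket t (der_act D u)"
proof (induction t rule: xsl_induct)
  case (tensor x a)
  show ?case
    by (induction u rule: xsl_induct)
      (simp_all add: der_act_zero der_act_add der_act_scale der_act_tensor tensor_simps
        xsl_bracket_zero_right xsl_bracket_add_right xsl_bracket_scale_right xsl_bracket_tensor
        der_apply_mult xsl.scale_right_distrib)
qed (simp_all add: der_act_zero der_act_add der_act_scale xsl_bracket_zero_left
    xsl_bracket_add_left xsl_bracket_scale_left xsl.scale_right_distrib)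

lemma xsl_bracket_commute: "xsl_bracket t u = - xsl_bracket u t"
proof (induction t rule: xsl_induct)
  case (tensor x a)
  show ?case
  proof (induction u rule: xsl_induct)
    case (tensor y b)
    have "sl_bracket a b = - sl_bracket b a"
      using sl.bracket_self[of "a + b"]
      by (simp only: sl.bracket_add_left sl.bracket_add_right sl.bracket_self[of a] sl.bracket_self[of b]
          eq_neg_iff_add_eq_0 add.commute add_0_left add_0_right)
    then show ?case
      by (simp add: xsl_bracket_tensor mult.commute tensor_minus_right)
  qed (simp_all add: xsl_bracket_zero_left xsl_bracket_zero_right
    xsl_bracket_add_left xsl_bracket_scale_left xsl_bracket_add_right xsl_bracket_scale_right)
qed (simp_all add: xsl_bracket_zero_left xsl_bracket_zero_right
    xsl_bracket_add_left xsl_bracket_scale_left xsl_bracket_add_right xsl_bracket_scale_right)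

lemma xsl_bracket_self: "xsl_bracket t t = 0"
proof (induction t rule: xsl_induct)
  case (add t u)
  then show ?case
    using xsl_bracket_commute[of t u] by (simp add: xsl_bracket_add_left xsl_bracket_add_right)
qed (simp_all add: xsl_bracket_zero_left xsl_bracket_scale_left xsl_bracket_scale_right
    xsl_bracket_tensor sl.bracket_self tensor_zero_right)

lemma xsl_jacobi:
  "xsl_bracket t (xsl_bracket u v) + xsl_bracket u (xsl_bracket v t) + xsl_bracket v (xsl_bracket t u) = 0"
  (is "?J t u v = 0")
proof (induction t rule: xsl_induct)
  case (tensor x a)
  show ?case
  proof (induction u rule: xsl_induct)
    case (tensor y b)
    show ?case
    proof (induction v rule: xsl_induct)
      case (tensor z c)
      have "y * (z * x) = x * (y * z)" "z * (x * y) = x * (y * z)" by (simp_all add: ac_simps)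
      then show ?case
        by (simp only: xsl_bracket_tensor sl.jacobi tensor_zero_right tensor_add_right[symmetric])
    next
      case (add v w)
      have "?J (x \<otimes> a) (y \<otimes> b) (v + w) = ?J (x \<otimes> a) (y \<otimes> b) v + ?J (x \<otimes> a) (y \<otimes> b) w"
        by (simp add: xsl_bracket_add_left xsl_bracket_add_right)
      then show ?case by (simp add: add)
    qed (simp_all add: xsl_bracket_zero_left xsl_bracket_zero_right xsl_bracket_scale_left xsl_bracket_scale_right
        flip: xsl.scale_right_distrib)
  next
    case (add u w)
    have "?J (x \<otimes> a) (u + w) v = ?J (x \<otimes> a) u v + ?J (x \<otimes> a) w v"
      by (simp add: xsl_bracket_add_left xsl_bracket_add_right)
    then show ?case by (simp add: add)
  qed (simp_all add: xsl_bracket_zero_left xsl_bracket_zero_right xsl_bracket_scale_left xsl_bracket_scale_right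
      flip: xsl.scale_right_distrib)
next
  case (add t w)
  have "?J (t + w) u v = ?J t u v + ?J w u v"
    by (simp add: xsl_bracket_add_left xsl_bracket_add_right)
  then show ?case by (simp add: add)
qed (simp_all add: xsl_bracket_zero_left xsl_bracket_zero_right xsl_bracket_scale_left xsl_bracket_scale_right
    flip: xsl.scale_right_distrib)

interpretation semi: lie_algebra semi_scale semi_bracket
proof unfold_locales
  fix p q r :: "('n::finite, 'k::field) semi"
  show "semi_bracket p (semi_bracket q r) + semi_bracket q (semi_bracket r p)
      + semi_bracket r (semi_bracket p q) = 0"
    using xsl_jacobi[of "fst p" "fst q" "fst r"] der.jacobi[of "snd p" "snd q" "snd r"]
      xsl_bracket_commute[of "fst p" "der_act (snd q) (fst r)"]
      xsl_bracket_commute[of "fst p" "der_act (snd r) (fst q)"]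
      xsl_bracket_commute[of "fst q" "der_act (snd r) (fst p)"]
      xsl_bracket_commute[of "fst q" "der_act (snd p) (fst r)"]
      xsl_bracket_commute[of "fst r" "der_act (snd p) (fst q)"]
      xsl_bracket_commute[of "fst r" "der_act (snd q) (fst p)"]
    by (simp add: semi_bracket_def prod_eq_iff xsl_bracket_diff_right xsl_bracket_add_right
        der_act_add der_act_diff der_act_xsl_bracket der_act_bracket_der algebra_simps)
qed (simp_all add: semi_scale_def semi_bracket_def prod_eq_iff xsl.scale_right_distrib
    xsl.scale_left_distrib der.scale_right_distrib der.scale_left_distrib xsl_bracket_add_left
    xsl_bracket_add_right xsl_bracket_scale_left xsl_bracket_scale_right xsl_bracket_self
    der_act_add der_act_scale der_act_add_der der_act_scale_der der.bracket_add_left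
    der.bracket_add_right der.bracket_scale_left der.bracket_scale_right der.bracket_self
    xsl.scale_right_diff_distrib)


section \<open>Tensor powers of \<open>X\<close>\<close>

text \<open>The type \<open>tpow\<close> is the direct sum of all tensor powers of \<open>X\<close>; the multilinear relations
  are homogeneous in the length of the lists, so \<open>tensor_power m\<close> is the \<open>m\<close>-th tensor power.\<close>

quotient_type (overloaded) ('n, 'k) tpow =
  "('n::finite, 'k::field) tpoly list \<Rightarrow>\<^sub>0 'k"
  / "\<lambda>t u. t - u \<in> module.span free_scale (multilinear_rels tscale)"
  by (rule equivp_span) (rule free.module_axioms)

definition ptens :: "('n::finite, 'k::field) tpoly list \<Rightarrow> ('n, 'k) tpow"
  where "ptens vs = abs_tpow (Poly_Mapping.single vs 1)"

instantiation tpow :: (finite, field) ab_group_add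
begin

lift_definition zero_tpow :: "('a, 'b) tpow" is 0 .

lift_definition plus_tpow :: "('a, 'b) tpow \<Rightarrow> ('a, 'b) tpow \<Rightarrow> ('a, 'b) tpow" is "(+)"
  unfolding add_diff_add by (rule free.span_add)

lift_definition uminus_tpow :: "('a, 'b) tpow \<Rightarrow> ('a, 'b) tpow" is uminus
  unfolding minus_diff_minus by (rule free.span_neg)

definition minus_tpow :: "('a, 'b) tpow \<Rightarrow> ('a, 'b) tpow \<Rightarrow> ('a, 'b) tpow"
  where "minus_tpow t u = t + - u"

instance
proof
  fix t u v :: "('a, 'b) tpow"
  show "t + u + v = t + (u + v)" by transfer (simp add: free.span_zero add.assoc)
  show "t + u = u + t" by transfer (simp add: free.span_zero add.commute)
  show "0 + t = t" by transfer (simp add: free.span_zero)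
  show "- t + t = 0" by transfer (simp add: free.span_zero)
  show "t - u = t + - u" by (rule minus_tpow_def)
qed

end

lift_definition tpow_scale :: "'k::field \<Rightarrow> ('n::finite, 'k) tpow \<Rightarrow> ('n, 'k) tpow" is free_scale
  unfolding free.scale_right_diff_distrib[symmetric] by (rule free.span_scale)

interpretation tpow: vector_space tpow_scale
  by unfold_locales
    (transfer, simp add: free.scale_right_distrib free.scale_left_distrib free.span_zero)+

definition tensor_power :: "nat \<Rightarrow> ('n::finite, 'k::field) tpow set"
  where "tensor_power m = tpow.span {ptens vs | vs. length vs = m}"

text \<open>As with \<open>xsl_lift\<close>, this is meaningful for multilinear \<open>g\<close>.\<close>

definition tpow_lift :: "('k::field \<Rightarrow> 'b::ab_group_add \<Rightarrow> 'b)
    \<Rightarrow> (('n::finite, 'k) tpoly list \<Rightarrow> 'b) \<Rightarrow> ('n, 'k) tpow \<Rightarrow> 'b"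
  where "tpow_lift s g t = free_lift s g (rep_tpow t)"

lemma
  shows ptens_add: "ptens (us @ (x + y) # vs) = ptens (us @ x # vs) + ptens (us @ y # vs)"
    and ptens_scale: "ptens (us @ tscale c x # vs) = tpow_scale c (ptens (us @ x # vs))"
proof -
  show "ptens (us @ (x + y) # vs) = ptens (us @ x # vs) + ptens (us @ y # vs)"
    unfolding ptens_def plus_tpow.abs_eq tpow.abs_eq_iff diff_diff_eq[symmetric]
    by (rule free.span_base) (unfold multilinear_rels_def, blast)
  show "ptens (us @ tscale c x # vs) = tpow_scale c (ptens (us @ x # vs))"
    unfolding ptens_def tpow_scale.abs_eq tpow.abs_eq_iff free_scale_single mult_1_right
    by (rule free.span_base) (unfold multilinear_rels_def, blast)
qed

context
  fixes s :: "'k::field \<Rightarrow> 'b::ab_group_add \<Rightarrow> 'b"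
    and g :: "('n::finite, 'k) tpoly list \<Rightarrow> 'b"
  assumes vs: "vector_space s"
    and g: "\<And>us x y vs. g (us @ (x + y) # vs) = g (us @ x # vs) + g (us @ y # vs)"
      "\<And>us c x vs. g (us @ tscale c x # vs) = s c (g (us @ x # vs))"
begin

lemma tpow_lift_abs: "tpow_lift s g (abs_tpow r) = free_lift s g r"
proof -
  interpret s: vector_space s by (rule vs)
  interpret Vector_Spaces.linear free_scale s "free_lift s g" by (rule linear_free_lift[OF vs])
  have "free_lift s g u = 0" if "u \<in> free.span (multilinear_rels tscale)" for u
    using that
  proof (induction rule: free.span_induct)
    case base
    show ?case by (auto simp: free.subspace_def add scale zero)
  next
    case (step u)
    then show ?case by (auto simp: multilinear_rels_def diff vs g)
  qed
  moreover have "rep_tpow (abs_tpow r) - r \<in> free.span (multilinear_rels tscale)"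
    by (rule Quotient3_rep_abs[OF Quotient3_tpow]) (simp add: free.span_zero)
  ultimately have "free_lift s g (rep_tpow (abs_tpow r) - r) = 0" by blast
  then show ?thesis by (simp add: tpow_lift_def diff)
qed

lemma linear_tpow_lift: "Vector_Spaces.linear tpow_scale s (tpow_lift s g)"
proof -
  have lin: "free_lift s g (x + y) = free_lift s g x + free_lift s g y"
    "free_lift s g (free_scale c x) = s c (free_lift s g x)" for x y c
    using linear_free_lift[OF vs, of g] by (simp_all add: Vector_Spaces.linear_iff)
  have "tpow_lift s g (t + u) = tpow_lift s g t + tpow_lift s g u" for t u
  proof (induction t rule: tpow.abs_induct)
    case (1 t)
    show ?case
      by (induction u rule: tpow.abs_induct) (simp add: plus_tpow.abs_eq tpow_lift_abs lin)
  qed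
  moreover have "tpow_lift s g (tpow_scale c t) = s c (tpow_lift s g t)" for c t
    by (induction t rule: tpow.abs_induct) (simp add: tpow_scale.abs_eq tpow_lift_abs lin)
  ultimately show ?thesis
    by (simp add: Vector_Spaces.linear_iff tpow.vector_space_axioms vs)
qed

lemma tpow_lift_ptens: "tpow_lift s g (ptens us) = g us"
  using vector_space.vector_space_assms(4)[OF vs] by (simp add: ptens_def tpow_lift_abs vs)

end


section \<open>Self-similarity\<close>

text \<open>\<open>tcons v t\<close> is \<open>v \<otimes> t\<close>, viewing \<open>X \<otimes> X\<^sup>\<otimes>\<^sup>m\<close> as the tensor power of exponent \<open>m + 1\<close>.\<close>

definition tcons :: "('n::finite, 'k::field) tpoly \<Rightarrow> ('n, 'k) tpow \<Rightarrow> ('n, 'k) tpow"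
  where "tcons v t = tpow_lift tpow_scale (\<lambda>vs. ptens (v # vs)) t"

text \<open>\<open>act_pure \<psi> [v\<^sub>1, \<dots>, v\<^sub>m] a\<close> is \<open>a \<cdot> (v\<^sub>1 \<otimes> \<dots> \<otimes> v\<^sub>m)\<close>, where \<open>fst (\<psi> a) = \<Sum>\<^sub>i z\<^sub>i \<otimes> a\<^sub>i\<close> and
  \<open>snd (\<psi> a) = \<delta>\<^sub>a\<close>. The value on the empty list, i.e. on the tensor power of exponent 0, is
  immaterial.\<close>

fun act_pure :: "(('n::finite, 'k::field) sl \<Rightarrow> ('n, 'k) semi) \<Rightarrow> ('n, 'k) tpoly list
    \<Rightarrow> ('n, 'k) sl \<Rightarrow> ('n, 'k) tpow" where
  "act_pure \<psi> [] a = 0"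
| "act_pure \<psi> [v] a = ptens [der_apply (snd (\<psi> a)) v]"
| "act_pure \<psi> (v # w # vs) a =
    xsl_lift tpow_scale (\<lambda>z b. tcons (z * v) (act_pure \<psi> (w # vs) b)) (fst (\<psi> a))
      + ptens (der_apply (snd (\<psi> a)) v # w # vs)"

definition tpow_act :: "(('n::finite, 'k::field) sl \<Rightarrow> ('n, 'k) semi) \<Rightarrow> ('n, 'k) sl
    \<Rightarrow> ('n, 'k) tpow \<Rightarrow> ('n, 'k) tpow"
  where "tpow_act \<psi> a t = tpow_lift tpow_scale (\<lambda>vs. act_pure \<psi> vs a) t"

lemma linear_tcons: "Vector_Spaces.linear tpow_scale tpow_scale (tcons v)"
  and tcons_ptens: "tcons v (ptens vs) = ptens (v # vs)"
proof -
  have *: "ptens (v # us @ (x + y) # vs) = ptens (v # us @ x # vs) + ptens (v # us @ y # vs)"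
    "ptens (v # us @ tscale c x # vs) = tpow_scale c (ptens (v # us @ x # vs))" for us x y vs c
    using ptens_add[of "v # us"] ptens_scale[of "v # us"] by simp_all
  show "Vector_Spaces.linear tpow_scale tpow_scale (tcons v)"
    unfolding tcons_def using linear_tpow_lift[OF tpow.vector_space_axioms *] .
  show "tcons v (ptens vs) = ptens (v # vs)"
    unfolding tcons_def by (rule tpow_lift_ptens[OF tpow.vector_space_axioms *])
qed

lemma
  shows tcons_add_right: "tcons v (t + u) = tcons v t + tcons v u"
    and tcons_scale_right: "tcons v (tpow_scale c t) = tpow_scale c (tcons v t)"
    and tcons_zero_right: "tcons v 0 = 0"
proof -
  interpret Vector_Spaces.linear tpow_scale tpow_scale "tcons v" by (rule linear_tcons)
  show "tcons v (t + u) = tcons v t + tcons v u" "tcons v (tpow_scale c t) = tpow_scale c (tcons v t)"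
    "tcons v 0 = 0" by (fact add scale zero)+
qed

lemma tpow_induct [case_names zero add scale ptens]:
  fixes t :: "('n::finite, 'k::field) tpow"
  assumes "P 0" "\<And>t u. P t \<Longrightarrow> P u \<Longrightarrow> P (t + u)" "\<And>c t. P t \<Longrightarrow> P (tpow_scale c t)" "\<And>vs. P (ptens vs)"
  shows "P t"
proof -
  have "P (abs_tpow r)" for r
  proof (induction r rule: free_induct)
    case zero
    show ?case using assms(1) unfolding zero_tpow.abs_eq .
  next
    case (add x y)
    show ?case using assms(2)[OF add] unfolding plus_tpow.abs_eq .
  next
    case (scale c x)
    show ?case using assms(3)[OF scale] unfolding tpow_scale.abs_eq .
  next
    case (single vs)
    show ?case using assms(4)[of vs] unfolding ptens_def .
  qed
  then show ?thesis by (induction t rule: tpow.abs_induct)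
qed

lemma
  shows tcons_add_left: "tcons (v + w) t = tcons v t + tcons w t"
    and tcons_scale_left: "tcons (tscale c v) t = tpow_scale c (tcons v t)"
proof -
  show "tcons (v + w) t = tcons v t + tcons w t"
    by (induction t rule: tpow_induct)
      (use ptens_add[of "[]"] in \<open>simp_all add: tcons_zero_right tcons_add_right tcons_scale_right
        tcons_ptens tpow.scale_right_distrib\<close>)
  show "tcons (tscale c v) t = tpow_scale c (tcons v t)"
    by (induction t rule: tpow_induct)
      (use ptens_scale[of "[]"] in \<open>simp_all add: tcons_zero_right tcons_add_right tcons_scale_right
        tcons_ptens tpow.scale_right_distrib mult.commute\<close>)
qed

lemma act_pure_Cons:
  "act_pure \<psi> (v # vs) a = xsl_lift tpow_scale (\<lambda>z b. tcons (z * v) (act_pure \<psi> vs b)) (fst (\<psi> a))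
    + ptens (der_apply (snd (\<psi> a)) v # vs)"
  by (cases vs) (simp_all add: tcons_zero_right xsl_lift_def free_lift_def)

context
  fixes \<psi> :: "('n::finite, 'k::field) sl \<Rightarrow> ('n, 'k) semi"
  assumes psi: "Vector_Spaces.linear sl_scale semi_scale \<psi>"
begin

lemma
  shows act_pure_add_sl: "act_pure \<psi> vs (a + b) = act_pure \<psi> vs a + act_pure \<psi> vs b"
    and act_pure_scale_sl: "act_pure \<psi> vs (sl_scale c a) = tpow_scale c (act_pure \<psi> vs a)"
proof (induction vs arbitrary: a b c)
  case (Cons v vs)
  let ?f = "\<lambda>z b. tcons (z * v) (act_pure \<psi> vs b)"
  have f: "?f (x + y) a = ?f x a + ?f y a" "?f x (a + b) = ?f x a + ?f x b"
    "?f (tscale c x) a = tpow_scale c (?f x a)" "?f x (sl_scale c a) = tpow_scale c (?f x a)" for x y a b c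
    by (simp_all add: Cons tcons_add_left tcons_add_right tcons_scale_left tcons_scale_right
        distrib_right tscale_mult_left)
  note lift = xsl_lift_add[OF tpow.vector_space_axioms f] xsl_lift_scale[OF tpow.vector_space_axioms f]
  have lin: "\<psi> (a + b) = \<psi> a + \<psi> b" "\<psi> (sl_scale c a) = semi_scale c (\<psi> a)" for a b c
    using psi by (simp_all add: Vector_Spaces.linear_iff)
  {
    case 1
    show ?case using ptens_add[of "[]"] by (simp add: act_pure_Cons lin lift)
  next
    case 2
    show ?case
      using ptens_scale[of "[]"] by (simp add: act_pure_Cons lin lift semi_scale_def tpow.scale_right_distrib)
  }
qed simp_all

lemma
  shows act_pure_add: "act_pure \<psi> (us @ (x + y) # vs) a = act_pure \<psi> (us @ x # vs) a + act_pure \<psi> (us @ y # vs) a"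
    and act_pure_scale: "act_pure \<psi> (us @ tscale c x # vs) a = tpow_scale c (act_pure \<psi> (us @ x # vs) a)"
proof (induction us arbitrary: a)
  case Nil
  {
    case 1
    show ?case
      using ptens_add[of "[]"]
      by (simp add: act_pure_Cons distrib_left tcons_add_left der_apply_add
          xsl_lift_plus_fun[OF tpow.vector_space_axioms])
  next
    case 2
    show ?case
      using ptens_scale[of "[]"]
      by (simp add: act_pure_Cons tscale_mult_right tcons_scale_left der_apply_scale
          xsl_lift_scale_fun[OF tpow.vector_space_axioms] tpow.scale_right_distrib)
  }
next
  case (Cons u us)
  {
    case 1
    show ?case
      using ptens_add[of "_ # us"]
      by (simp add: act_pure_Cons Cons tcons_add_right xsl_lift_plus_fun[OF tpow.vector_space_axioms])
  next
    case 2
    show ?case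
      using ptens_scale[of "_ # us"]
      by (simp add: act_pure_Cons Cons tcons_scale_right
          xsl_lift_scale_fun[OF tpow.vector_space_axioms] tpow.scale_right_distrib)
  }
qed

lemma linear_tpow_act: "Vector_Spaces.linear tpow_scale tpow_scale (tpow_act \<psi> a)"
  unfolding tpow_act_def
  using linear_tpow_lift[of tpow_scale "\<lambda>vs. act_pure \<psi> vs a", OF tpow.vector_space_axioms
      act_pure_add act_pure_scale] .

lemma tpow_act_ptens: "tpow_act \<psi> a (ptens vs) = act_pure \<psi> vs a"
  unfolding tpow_act_def
  by (rule tpow_lift_ptens[OF tpow.vector_space_axioms act_pure_add act_pure_scale])

lemma tpow_act_tcons:
  "tpow_act \<psi> a (tcons v t) =
    xsl_lift tpow_scale (\<lambda>z b. tcons (z * v) (tpow_act \<psi> b t)) (fst (\<psi> a))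
      + tcons (der_apply (snd (\<psi> a)) v) t"
proof (induction t rule: tpow_induct)
  case zero
  have "tpow_act \<psi> b 0 = 0" for b
    using linear_tpow_act[of b] by (rule module_hom.zero[OF Vector_Spaces.linear.axioms(3)])
  then show ?case by (simp add: tcons_zero_right xsl_lift_def free_lift_def)
next
  case (add t u)
  then show ?case
    using linear_tpow_act
    by (simp add: Vector_Spaces.linear_iff tcons_add_right xsl_lift_plus_fun[OF tpow.vector_space_axioms])
next
  case (scale c t)
  then show ?case
    using linear_tpow_act
    by (simp add: Vector_Spaces.linear_iff tcons_scale_right tpow.scale_right_distrib
        xsl_lift_scale_fun[OF tpow.vector_space_axioms])
next
  case (ptens vs)
  show ?case by (simp add: tcons_ptens tpow_act_ptens act_pure_Cons)
qed

end

definition act_kernel :: "(('n::finite, 'k::field) sl \<Rightarrow> ('n, 'k) semi) \<Rightarrow> nat \<Rightarrow> ('n, 'k) sl set"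
  where "act_kernel \<psi> m = {a. \<forall>t\<in>tensor_power m. tpow_act \<psi> a t = 0}"

definition self_similar :: "(('n::finite, 'k::field) sl \<Rightarrow> ('n, 'k) semi) \<Rightarrow> bool"
  where "self_similar \<psi> \<longleftrightarrow> lie_algebra_hom sl_scale sl_bracket semi_scale semi_bracket \<psi>
    \<and> inj \<psi> \<and> \<not> range \<psi> \<subseteq> UNIV \<times> {0} \<and> \<not> range \<psi> \<subseteq> {0} \<times> UNIV"

definition faithful_self_similar :: "(('n::finite, 'k::field) sl \<Rightarrow> ('n, 'k) semi) \<Rightarrow> bool"
  where "faithful_self_similar \<psi> \<longleftrightarrow> self_similar \<psi> \<and> (\<Inter>m\<in>{1..}. act_kernel \<psi> m) = {0}"

end

(* On the generators, the Der X component of psi is the inclusion of sl_{n+1}. Hence injectivity is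
   clear, and faithfulness already holds on X itself. The X (x) sl_{n+1} component is given by a
   closed formula that is linear on all of Der X: the negated Jacobian matrix of D plus a multiple of
   the gradient of the divergence of D, divided by n + 1. So psi is well defined without choosing a
   basis of sl_{n+1}, and it is a homomorphism iff this component satisfies a cocycle identity, which
   is bilinear and needs to be checked on the generators only. *)
theory Submission
  imports Defs
begin

section \<open>Identities for brackets, tensors and matrix units\<close>

lemma (in lie_algebra)
  shows bracket_diff_left: "bracket (x - y) z = bracket x z - bracket y z"
    and bracket_diff_right: "bracket x (y - z) = bracket x y - bracket x z"
    and bracket_zero_left: "bracket 0 x = 0"
    and bracket_zero_right: "bracket x 0 = 0"
    and bracket_commute: "bracket x y = - bracket y x"
proof -
  show "bracket (x - y) z = bracket x z - bracket y z" "bracket x (y - z) = bracket x y - bracket x z"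
    using bracket_add_left[of "x - y" y z] bracket_add_right[of x "y - z" z] by simp_all
  show "bracket 0 x = 0" "bracket x 0 = 0"
    using bracket_add_left[of 0 0 x] bracket_add_right[of x 0 0] by simp_all
  show "bracket x y = - bracket y x"
    using bracket_self[of "x + y"] bracket_self[of x] bracket_self[of y]
    by (simp only: bracket_add_left bracket_add_right eq_neg_iff_add_eq_0 add.commute add_0_left add_0_right)
qed

lemma tensor_sum_right: "x \<otimes> sum f A = (\<Sum>i\<in>A. x \<otimes> f i)"
  by (induction A rule: infinite_finite_induct) (simp_all add: tensor_zero_right tensor_add_right)

lemma tensor_minus_left: "(- x) \<otimes> a = - (x \<otimes> a)"
  using tensor_diff_left[of 0 x a] by (simp add: tensor_zero_left)

lemma tensor_diff_right: "x \<otimes> (a - b) = x \<otimes> a - x \<otimes> b"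
  using tensor_add_right[of x "a - b" b] by simp

lemma xsl_bracket_sum_left: "xsl_bracket (sum f A) u = (\<Sum>i\<in>A. xsl_bracket (f i) u)"
  by (induction A rule: infinite_finite_induct) (simp_all add: xsl_bracket_zero_left xsl_bracket_add_left)

lemma xsl_bracket_sum_right: "xsl_bracket u (sum f A) = (\<Sum>i\<in>A. xsl_bracket u (f i))"
  by (induction A rule: infinite_finite_induct) (simp_all add: xsl_bracket_zero_right xsl_bracket_add_right)

lemma der_act_sum: "der_act D (sum f A) = (\<Sum>i\<in>A. der_act D (f i))"
  by (induction A rule: infinite_finite_induct) (simp_all add: der_act_zero der_act_add)

lemma sl_der_sum: "sl_der (sum f A) = (\<Sum>i\<in>A. sl_der (f i))"
  by (induction A rule: infinite_finite_induct) (simp_all add: sl_rep_eqs)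

lemma sl_E_None_None: "sl_E None None = - (\<Sum>l\<in>UNIV. sl_E (Some l) (Some l))"
  by (rule sl_eqI) (simp add: sl_rep_eqs sl_der_sum der_E_None_None del: der_E.simps)

lemma sl_bracket_E:
  "sl_bracket (sl_E i j) (sl_E k l) = (if j = k then sl_E i l else 0) - (if i = l then sl_E k j else 0)"
  by (rule sl_eqI) (simp add: sl_rep_eqs bracket_der_E del: der_E.simps)

text \<open>A derivation is determined by its values on the variables. With
  \<open>der_E.simps\<close> deleted from the simpset, these rules evaluate the generators while
  keeping them folded.\<close>

lemma der_E_apply_simps:
  "der_apply (der_E (Some k) (Some l)) (tvar j) = (if k = j then - tvar l else 0)"
  "der_apply (der_E (Some k) None) (tvar j) = (if k = j then 1 else 0)"
  "der_apply (der_E None (Some k)) (tvar j) = - (tvar k * tvar j)"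
  by (simp_all add: der_E_apply_var del: der_E.simps)

lemma sum_tensor_sl_b:
  "(\<Sum>j\<in>UNIV. tvar j \<otimes> sl_b i j) = (\<Sum>j\<in>UNIV. tvar j \<otimes> sl_E (Some j) (Some i)) - tvar i \<otimes> sl_E None None"
  by (simp add: sl_b_def tensor_diff_right sum_subtractf tensor_zero_right if_distrib[of "(\<otimes>) _"] cong: if_cong)

text \<open>Three families of generators suffice because $E_{n+1,n+1}$ is not in
  \<open>sl_gens\<close>. They have constant, linear and quadratic coefficients, which gives the
  cases their names.\<close>

lemma sl_induct [case_names zero add scale partial linear quadratic]:
  fixes a :: "('n::finite, 'k::field) sl"
  assumes zero: "P 0" and add: "\<And>a b. P a \<Longrightarrow> P b \<Longrightarrow> P (a + b)" and scale: "\<And>c a. P a \<Longrightarrow> P (sl_scale c a)"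
    and E: "\<And>i. P (sl_E (Some i) None)" "\<And>i j. P (sl_E (Some i) (Some j))" "\<And>i. P (sl_E None (Some i))"
  shows "P a"
proof -
  \<comment> \<open>Membership in the span is carried along because \<open>Abs_sl_inverse\<close>
    requires it at every sum and scalar multiple.\<close>
  have "P (Abs_sl D) \<and> D \<in> der.span sl_gens" if "D \<in> der.span sl_gens" for D :: "('n, 'k) der"
    using that
  proof (induction rule: der.span_induct)
    case base
    show ?case
    proof (unfold der.subspace_def, safe)
      show "P (Abs_sl 0)" using zero by (simp add: zero_sl_def)
      fix D D' :: "('n, 'k) der" and c
      assume D: "P (Abs_sl D)" "D \<in> der.span sl_gens"
      show "P (Abs_sl (der_scale c D))"
        using scale[OF D(1), of c] D(2) by (simp add: sl_scale_def Abs_sl_inverse)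
      assume D': "P (Abs_sl D')" "D' \<in> der.span sl_gens"
      show "P (Abs_sl (D + D'))"
        using add[OF D(1) D'(1)] D(2) D'(2) by (simp add: plus_sl_def Abs_sl_inverse)
    qed (auto intro: der.span_zero der.span_add der.span_scale)
  next
    case (step D)
    then obtain i j where D: "D = der_E i j" "\<not> (i = None \<and> j = None)"
      unfolding sl_gens_def by blast
    have "P (sl_E i j)" using D(2) E by (cases i; cases j) auto
    then show ?case using step D(1) by (auto simp: sl_E_def intro: der.span_base)
  qed
  from this[OF sl_der[of a]] show ?thesis by (simp add: sl_der_inverse)
qed

section \<open>A closed formula for the embedding\<close>

definition divergence :: "('n::finite, 'k::field) der \<Rightarrow> ('n, 'k) tpoly"
  where "divergence D = (\<Sum>m\<in>UNIV. der_apply (der_partial m) (der_apply D (tvar m)))"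

text \<open>The second sum reads off the quadratic part of \<open>D\<close>, since \<open>E\<^sub>n\<^sub>+\<^sub>1\<^sub>,\<^sub>i\<close> has
  divergence \<open>- (n + 1) x\<^sub>i\<close>.\<close>

definition jet :: "('n::finite, 'k::field) der \<Rightarrow> ('n, 'k) xsl"
  where "jet D =
    - (\<Sum>l\<in>UNIV. \<Sum>m\<in>UNIV. der_apply (der_partial l) (der_apply D (tvar m)) \<otimes> sl_E (Some m) (Some l))
    - xsl_scale (inverse (of_nat (CARD('n) + 1)))
        (\<Sum>i\<in>UNIV. der_apply (der_partial i) (divergence D) \<otimes> sl_E None (Some i))"

definition jet_embedding :: "('n::finite, 'k::field) sl \<Rightarrow> ('n, 'k) semi"
  where "jet_embedding a = (jet (sl_der a), sl_der a)"

lemma divergence_add: "divergence (D + D') = divergence D + divergence D'"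
  and divergence_scale: "divergence (der_scale c D) = tscale c (divergence D)"
  by (simp_all add: divergence_def der_apply_add der_apply_scale sum.distrib tpoly.scale_sum_right)

lemma jet_add: "jet (D + D') = jet D + jet D'"
  by (simp add: jet_def divergence_add der_apply_add sum.distrib tensor_add_left xsl.scale_right_distrib)

lemma jet_scale: "jet (der_scale c D) = xsl_scale c (jet D)"
  by (simp add: jet_def divergence_scale der_apply_scale tensor_scale_left mult.commute
      flip: xsl.scale_sum_right add: xsl.scale_right_diff_distrib)

lemma jet_zero: "jet 0 = 0"
  using jet_add[of 0 0] by simp

lemma jet_minus: "jet (- D) = - jet D"
  using jet_add[of D "- D"] by (simp add: jet_zero eq_neg_iff_add_eq_0 add.commute)

lemma jet_diff: "jet (D - D') = jet D - jet D'"
  by (simp only: diff_conv_add_uminus jet_add jet_minus)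

lemma jet_sum: "jet (sum f A) = (\<Sum>i\<in>A. jet (f i))"
  by (induction A rule: infinite_finite_induct) (simp_all add: jet_zero jet_add)

lemma linear_jet_embedding: "Vector_Spaces.linear sl_scale semi_scale jet_embedding"
  by (simp add: Vector_Spaces.linear_iff sl.vector_space_axioms semi.vector_space_axioms
      jet_embedding_def sl_rep_eqs jet_add jet_scale semi_scale_def)

section \<open>Values of the formula on the generators\<close>

lemma jet_partial: "jet (der_E (Some i) None) = 0"
proof -
  have "der_apply (der_E (Some i) None) (tvar m) = (if i = m then 1 else 0)" for m
    by simp
  then have *: "der_apply (der_partial l) (der_apply (der_E (Some i) None) (tvar m)) = 0" for l m
    by (simp add: der_apply_0 der_apply_1)
  show ?thesis
    by (simp add: jet_def divergence_def * der_apply_0 tensor_zero_left del: der_E.simps)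
qed

text \<open>The coefficients are linear, so the Jacobian matrix is constant with the single entry
  -1, and the gradient of the constant divergence vanishes.\<close>

lemma jet_linear: "jet (der_E (Some i) (Some j)) = 1 \<otimes> sl_E (Some i) (Some j)"
  (is "jet ?D = _")
proof -
  have *: "der_apply (der_partial l) (der_apply ?D (tvar m))
      = (if m = i then if l = j then - 1 else 0 else 0)" for l m
    by (auto simp: der_E_apply_var der_apply_0 der_apply_uminus simp del: der_E.simps)
  have "divergence ?D = (if i = j then - 1 else 0)"
    unfolding divergence_def * by simp
  then have "der_apply (der_partial l) (divergence ?D) = 0" for l
    by (simp add: der_apply_0 der_apply_1 der_apply_uminus del: der_E.simps)
  then show ?thesis
    unfolding jet_def * 
    by (simp add: tensor_zero_left tensor_minus_left if_distrib[of "\<lambda>x. x \<otimes> _"]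
       sum_negf cong: if_cong del: der_E.simps)
qed

lemma jet_None_None: "jet (der_E None None) = 1 \<otimes> sl_E None None"
  unfolding der_E_None_None sl_E_None_None jet_minus jet_sum jet_linear
  by (simp add: tensor_minus_right tensor_sum_right)

lemma jet_quadratic:
  assumes "\<not> CHAR('k::field) dvd CARD('n::finite) + 1"
  shows "jet (der_E None (Some i) :: ('n, 'k) der) =
    (\<Sum>j\<in>UNIV. tvar j \<otimes> sl_b i j) + 1 \<otimes> sl_E None (Some i)"
proof -
  let ?D = "der_E None (Some i) :: ('n, 'k) der"
  have N: "(of_nat (CARD('n) + 1) :: 'k) \<noteq> 0"
    using assms by (simp only: of_nat_eq_0_iff_char_dvd) simp
  have *: "der_apply (der_partial l) (der_apply ?D (tvar m))
      = - (if l = i then tvar m else 0) - (if l = m then tvar i else 0)" for l m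
    by (auto simp: der_E_apply_simps der_apply_uminus der_apply_mult simp del: der_E.simps)
  \<comment> \<open>Euler's count: the product of \<open>tvar i\<close> and \<open>tvar m\<close>
    contributes \<open>tvar i\<close> once for each of the n values of m, and once more for m =
    i.\<close>
  have "divergence ?D = - (\<Sum>m\<in>UNIV. if m = i then tvar m else 0) - (\<Sum>m\<in>(UNIV :: 'n set). tvar i)"
    unfolding divergence_def * by (simp add: sum_subtractf sum_negf)
  also have "(\<Sum>m\<in>(UNIV :: 'n set). tvar i) = tscale (of_nat CARD('n)) (tvar i :: ('n, 'k) tpoly)"
    by (simp only: tpoly.sum_constant_scale)
  finally have "divergence ?D = - tscale (of_nat (CARD('n) + 1)) (tvar i)"
    by (simp add: tpoly.scale_left_distrib)
  then have "xsl_scale (inverse (of_nat (CARD('n) + 1)))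
        (\<Sum>l\<in>UNIV. der_apply (der_partial l) (divergence ?D) \<otimes> sl_E None (Some l))
      = - (1 \<otimes> sl_E None (Some i))"
    using N
    by (simp add: der_apply_uminus der_apply_scale tensor_minus_left tensor_scale_left
        sum_negf if_distrib[of "\<lambda>x. x \<otimes> _"] tensor_zero_left if_distrib[of "xsl_scale _"]
        cong: if_cong del: der_E.simps of_nat_add of_nat_Suc)
  moreover have "(\<Sum>l\<in>UNIV. \<Sum>m\<in>UNIV. der_apply (der_partial l) (der_apply ?D (tvar m)) \<otimes> sl_E (Some m) (Some l))
      = - (\<Sum>m\<in>UNIV. tvar m \<otimes> sl_E (Some m) (Some i)) - tvar i \<otimes> (\<Sum>l\<in>UNIV. sl_E (Some l) (Some l))"
  proof -
    have "(\<Sum>l\<in>UNIV. \<Sum>m\<in>UNIV. (if l = i then tvar m else 0) \<otimes> sl_E (Some m) (Some l))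
        = (\<Sum>l\<in>UNIV. if l = i then \<Sum>m\<in>UNIV. tvar m \<otimes> sl_E (Some m) (Some l) else 0 :: ('n, 'k) xsl)"
      by (intro sum.cong) (auto simp: tensor_zero_left)
    moreover have "(\<Sum>m\<in>UNIV. (if l = m then tvar i else 0) \<otimes> sl_E (Some m) (Some l))
        = (tvar i \<otimes> sl_E (Some l) (Some l) :: ('n, 'k) xsl)" for l
      by (simp add: if_distrib[of "\<lambda>x. x \<otimes> _"] tensor_zero_left cong: if_cong)
    ultimately show ?thesis
      unfolding *
      by (simp add: tensor_diff_left tensor_minus_left sum_subtractf sum_negf tensor_sum_right)
  qed
  ultimately show ?thesis
    by (simp add: jet_def sum_tensor_sl_b sl_E_None_None tensor_minus_right del: der_E.simps)
qed

section \<open>The cocycle identity\<close>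

text \<open>This is the first component of the homomorphism equation for
  \<open>jet_embedding\<close>. The second component holds by definition of
  \<open>sl_bracket\<close>.\<close>

definition cocycle_at :: "('n::finite, 'k::field) sl \<Rightarrow> ('n, 'k) sl \<Rightarrow> bool"
  where "cocycle_at a b \<longleftrightarrow> jet (sl_der (sl_bracket a b)) =
    xsl_bracket (jet (sl_der a)) (jet (sl_der b)) + der_act (sl_der a) (jet (sl_der b))
      - der_act (sl_der b) (jet (sl_der a))"

text \<open>Both sides of the identity are antisymmetric. This halves the pairs of generators to be
  checked and makes linearity in the first argument enough.\<close>

lemma cocycle_at_commute: "cocycle_at a b \<longleftrightarrow> cocycle_at b a"
proof -
  have *: "cocycle_at b a" if "cocycle_at a b" for a b :: "('n::finite, 'k::field) sl"
  proof -
    have "sl_bracket b a = - sl_bracket a b"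
      by (rule sl.bracket_commute)
    then show ?thesis
      using that xsl_bracket_commute[of "jet (sl_der b)" "jet (sl_der a)"]
      by (simp add: cocycle_at_def uminus_sl.rep_eq jet_minus)
  qed
  show ?thesis by (blast intro: *)
qed

lemma cocycle_at_zero: "cocycle_at 0 b"
  \<comment> \<open>This instance shows that the zero derivation acts as zero.\<close>
  using der_act_add_der[of 0 0]
  by (simp add: cocycle_at_def sl_rep_eqs jet_zero xsl_bracket_zero_left der_act_zero der.bracket_zero_left)

lemma cocycle_at_add: "cocycle_at a b \<Longrightarrow> cocycle_at a' b \<Longrightarrow> cocycle_at (a + a') b"
  by (simp add: cocycle_at_def sl.bracket_add_left plus_sl.rep_eq jet_add xsl_bracket_add_left
      der_act_add der_act_add_der)

lemma cocycle_at_scale: "cocycle_at a b \<Longrightarrow> cocycle_at (sl_scale c a) b"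
  by (simp add: cocycle_at_def sl.bracket_scale_left sl_scale.rep_eq jet_scale xsl_bracket_scale_left
      der_act_scale der_act_scale_der xsl.scale_right_distrib xsl.scale_right_diff_distrib)

lemma cocycle_at_partial_partial: "cocycle_at (sl_E (Some i) None) (sl_E (Some j) None)"
  by (simp add: cocycle_at_def sl_bracket_E sl_rep_eqs jet_partial jet_zero
      xsl_bracket_zero_right der_act_zero del: der_E.simps)

lemma cocycle_at_linear_partial: "cocycle_at (sl_E (Some i) (Some j)) (sl_E (Some k) None)"
  by (auto simp: cocycle_at_def sl_bracket_E sl_rep_eqs jet_linear jet_partial jet_diff jet_zero jet_minus
      xsl_bracket_zero_right der_act_zero der_act_tensor der_apply_1 tensor_zero_left simp del: der_E.simps)

text \<open>Derivations kill 1, so both \<open>der_act\<close> terms vanish and what is left is that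
  \<open>a \<mapsto> 1 \<otimes> a\<close> respects brackets.\<close>

lemma cocycle_at_linear_linear: "cocycle_at (sl_E (Some i) (Some j)) (sl_E (Some k) (Some l))"
  by (simp add: cocycle_at_def sl_bracket_E sl_rep_eqs jet_linear jet_diff jet_zero jet_minus
      xsl_bracket_tensor der_act_tensor der_apply_1 tensor_zero_left tensor_zero_right tensor_diff_right
      tensor_minus_right del: der_E.simps)

lemma cocycle_at_quadratic_partial:
  assumes "\<not> CHAR('k::field) dvd CARD('n::finite) + 1"
  shows "cocycle_at (sl_E None (Some i) :: ('n, 'k) sl) (sl_E (Some j) None)"
proof -
  have "jet (sl_der (sl_bracket (sl_E None (Some i)) (sl_E (Some j) None) :: ('n, 'k) sl)) = - (1 \<otimes> sl_b i j)"
    by (simp add: sl_bracket_E sl_b_def sl_rep_eqs jet_diff jet_zero jet_minus jet_linear jet_None_None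
        tensor_diff_right tensor_zero_right del: der_E.simps)
  then show ?thesis
    by (simp add: cocycle_at_def sl_E.rep_eq jet_partial jet_quadratic[OF assms] xsl_bracket_zero_right
        der_act_zero der_act_add der_act_sum der_act_tensor der_apply_1 der_E_apply_simps tensor_zero_left
        if_distrib[of "\<lambda>x. x \<otimes> _"] cong: if_cong del: der_E.simps)
qed

lemma cocycle_at_linear_quadratic:
  assumes "\<not> CHAR('k::field) dvd CARD('n::finite) + 1"
  shows "cocycle_at (sl_E (Some k) (Some l) :: ('n, 'k) sl) (sl_E None (Some i))"
proof -
  let ?S = "\<Sum>j\<in>UNIV. tvar j \<otimes> sl_b i j :: ('n, 'k) xsl"
  let ?T = "\<Sum>j\<in>UNIV. tvar j \<otimes> sl_E (Some j) (Some l) :: ('n, 'k) xsl"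
  have "sl_bracket (sl_E (Some k) (Some l)) (sl_b i j)
      = (if j = l then sl_E (Some k) (Some i) else 0) - (if k = i then sl_E (Some j) (Some l) else 0 :: ('n, 'k) sl)" for j
    by (auto simp: sl_b_def sl.bracket_diff_right sl.bracket_zero_right sl_bracket_E)
  then have A: "xsl_bracket (1 \<otimes> sl_E (Some k) (Some l)) ?S
      = tvar l \<otimes> sl_E (Some k) (Some i) - (if k = i then ?T else 0)"
    by (simp add: xsl_bracket_sum_right xsl_bracket_tensor tensor_diff_right sum_subtractf
        if_distrib[of "(\<otimes>) _"] tensor_zero_right cong: if_cong)
  have "der_act (der_E (Some k) (Some l)) ?S = - (tvar l \<otimes> sl_b i k)"
    by (simp add: der_act_sum der_act_tensor der_E_apply_simps if_distrib[of "\<lambda>x. x \<otimes> _"]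
        tensor_zero_left tensor_minus_left cong: if_cong del: der_E.simps)
  then have B: "der_act (der_E (Some k) (Some l)) ?S
      = - (tvar l \<otimes> sl_E (Some k) (Some i)) + (if k = i then tvar l \<otimes> sl_E None None else 0)"
    by (simp add: sl_b_def tensor_diff_right tensor_zero_right del: der_E.simps)
  \<comment> \<open>The terms \<open>tvar l \<otimes> sl_E (Some k) (Some i)\<close> of A and B
    cancel. For k = i the rest is the negative of the sum for index l, split by
    \<open>sum_tensor_sl_b\<close>; only that instance is given, so that the sum for i still matches
    A and B.\<close>
  show ?thesis
    by (cases "k = i") (use A B in \<open>simp_all add: cocycle_at_def sl_E.rep_eq sl_bracket_E zero_sl.rep_eq
        uminus_sl.rep_eq jet_minus jet_zero jet_linear jet_quadratic[OF assms] sum_tensor_sl_b[of l]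
        xsl_bracket_add_right xsl_bracket_tensor der_act_add der_act_tensor der_apply_1
        tensor_zero_left tensor_zero_right tensor_minus_right del: der_E.simps\<close>)
qed

text \<open>Quadratic generators commute, so the right-hand side has to cancel completely: SQ
  against QS, and SS against the two instances of D, whose $E_{n+1,n+1}$ terms agree by symmetry in
  i and k.\<close>

lemma cocycle_at_quadratic_quadratic:
  assumes "\<not> CHAR('k::field) dvd CARD('n::finite) + 1"
  shows "cocycle_at (sl_E None (Some i) :: ('n, 'k) sl) (sl_E None (Some k))"
proof -
  let ?S = "\<lambda>i. \<Sum>j\<in>UNIV. tvar j \<otimes> sl_b i j :: ('n, 'k) xsl"
  let ?T = "\<lambda>i k. \<Sum>j\<in>UNIV. (tvar i * tvar j) \<otimes> sl_E (Some j) (Some k) :: ('n, 'k) xsl"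
  \<comment> \<open>The summand $E_{n+1,n+1}$ of \<open>sl_b\<close> commutes with all $E_{i,j}$ for
    $i, j \<le> n$, so only matrix units of size n contribute.\<close>
  have bb: "sl_bracket (sl_b i j) (sl_b k l)
      = (if l = i then sl_E (Some j) (Some k) else 0) - (if j = k then sl_E (Some l) (Some i) else 0 :: ('n, 'k) sl)" for j l
    by (auto simp: sl_b_def sl.bracket_diff_right sl.bracket_diff_left sl.bracket_zero_left
        sl.bracket_zero_right sl_bracket_E)
  have "xsl_bracket (?S i) (?S k)
      = (\<Sum>l\<in>UNIV. if l = i then \<Sum>j\<in>UNIV. (tvar j * tvar l) \<otimes> sl_E (Some j) (Some k) else 0)
        - (\<Sum>l\<in>UNIV. \<Sum>j\<in>UNIV. if j = k then (tvar j * tvar l) \<otimes> sl_E (Some l) (Some i) else 0 :: ('n, 'k) xsl)"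
    unfolding xsl_bracket_sum_left xsl_bracket_sum_right xsl_bracket_tensor bb sum_subtractf[symmetric]
    by (intro sum.cong) (auto simp: tensor_diff_right tensor_zero_right sum_subtractf if_distrib[of "(\<otimes>) _"] cong: if_cong)
  then have SS: "xsl_bracket (?S i) (?S k) = ?T i k - ?T k i"
    by (simp add: mult.commute)
  have "sl_bracket (sl_b i j) (sl_E None (Some k))
      = - (if j = k then sl_E None (Some i) else 0) - (if i = j then sl_E None (Some k) else 0 :: ('n, 'k) sl)" for i j k
    by (auto simp: sl_b_def sl.bracket_diff_left sl.bracket_zero_left sl_bracket_E)
  then have SQ: "xsl_bracket (?S i) (1 \<otimes> sl_E None (Some k))
      = - (tvar k \<otimes> sl_E None (Some i)) - tvar i \<otimes> sl_E None (Some k)" for i k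
    by (simp add: xsl_bracket_sum_left xsl_bracket_tensor tensor_diff_right tensor_minus_right sum_subtractf
        sum_negf if_distrib[of "(\<otimes>) _"] tensor_zero_right cong: if_cong)
  have QS: "xsl_bracket (1 \<otimes> sl_E None (Some i)) (?S k)
      = tvar i \<otimes> sl_E None (Some k) + tvar k \<otimes> sl_E None (Some i)"
    by (subst xsl_bracket_commute) (simp add: SQ)
  have D: "der_act (der_E None (Some i)) (?S k)
      = - ?T i k + (tvar i * tvar k) \<otimes> (sl_E None None :: ('n, 'k) sl)" for i k
    by (simp add: sum_tensor_sl_b der_act_diff der_act_sum der_act_tensor der_E_apply_simps tensor_minus_left
        sum_negf del: der_E.simps)
  show ?thesis
    by (simp add: cocycle_at_def sl_E.rep_eq sl_bracket_E zero_sl.rep_eq jet_zero jet_quadratic[OF assms]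
        xsl_bracket_add_right xsl_bracket_add_left xsl_bracket_tensor sl_bracket_E der_act_add der_act_tensor
        der_apply_1 SS SQ QS D tensor_zero_left tensor_zero_right mult.commute del: der_E.simps)
qed

lemma cocycle_at:
  assumes "\<not> CHAR('k::field) dvd CARD('n::finite) + 1"
  shows "cocycle_at (a :: ('n, 'k) sl) b"
proof (induction a rule: sl_induct)
  case (partial i)
  show ?case
    \<comment> \<open>The closure lemmas concern the first argument only, so b is moved there before
      the inner induction.\<close>
    by (subst cocycle_at_commute, induction b rule: sl_induct)
      (simp_all add: cocycle_at_zero cocycle_at_add cocycle_at_scale cocycle_at_partial_partial
        cocycle_at_linear_partial cocycle_at_quadratic_partial[OF assms])
next
  case (linear k l)
  show ?case
    by (subst cocycle_at_commute, induction b rule: sl_induct)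
      (simp_all add: cocycle_at_zero cocycle_at_add cocycle_at_scale cocycle_at_linear_linear
        \<comment> \<open>These instances swap only pairs starting with a partial derivative or a
          quadratic generator, into the order in which the pairs were checked.\<close>
        cocycle_at_commute[of "sl_E (Some _) None"] cocycle_at_commute[of "sl_E None (Some _)"]
        cocycle_at_linear_partial cocycle_at_linear_quadratic[OF assms])
next
  case (quadratic i)
  show ?case
    by (subst cocycle_at_commute, induction b rule: sl_induct)
      (simp_all add: cocycle_at_zero cocycle_at_add cocycle_at_scale
        cocycle_at_commute[of "sl_E (Some _) None"] cocycle_at_quadratic_partial[OF assms]
        cocycle_at_linear_quadratic[OF assms] cocycle_at_quadratic_quadratic[OF assms])
qed (simp_all add: cocycle_at_zero cocycle_at_add cocycle_at_scale)

section \<open>Homomorphism and injectivity\<close>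

lemma lie_algebra_hom_jet_embedding:
  assumes "\<not> CHAR('k::field) dvd CARD('n::finite) + 1"
  shows "lie_algebra_hom sl_scale sl_bracket semi_scale semi_bracket
    (jet_embedding :: ('n, 'k) sl \<Rightarrow> ('n, 'k) semi)"
proof -
  interpret Vector_Spaces.linear sl_scale semi_scale "jet_embedding :: ('n, 'k) sl \<Rightarrow> ('n, 'k) semi"
    by (rule linear_jet_embedding)
  show ?thesis
    by unfold_locales
      (use cocycle_at[OF assms] in \<open>simp add: jet_embedding_def semi_bracket_def cocycle_at_def sl_bracket.rep_eq\<close>)
qed

lemma inj_jet_embedding: "inj jet_embedding"
  by (auto simp: inj_def jet_embedding_def intro: sl_eqI)

section \<open>Nonvanishing tensors and faithfulness\<close>

text \<open>Since Der X is an X-module, \<open>x \<otimes> b\<close> can be sent to the derivation x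
  b. This linear map takes \<open>1 \<otimes> a\<close> back to a.\<close>

lemma one_tensor_eq_0_iff:
  fixes a :: "('n::finite, 'k::field) sl"
  shows "1 \<otimes> a = 0 \<longleftrightarrow> a = 0"
proof
  let ?f = "\<lambda>x b. der_mult x (sl_der b) :: ('n, 'k) der"
  have f: "?f (x + y) a = ?f x a + ?f y a" "?f x (a + b) = ?f x a + ?f x b"
    "?f (tscale c x) a = der_scale c (?f x a)" "?f x (sl_scale c a) = der_scale c (?f x a)" for x y a b c
    by (auto intro!: der_eqI simp: sl_rep_eqs tscale_mult_left tscale_mult_right algebra_simps)
  assume "1 \<otimes> a = 0"
  then have "xsl_lift der_scale ?f (1 \<otimes> a) = xsl_lift der_scale ?f 0"
    by simp
  also have "\<dots> = 0"
    using xsl_lift_add[of der_scale ?f, OF der.vector_space_axioms f, of 0 0] by simp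
  finally have "der_mult 1 (sl_der a) = 0"
    by (simp add: xsl_lift_tensor[of der_scale ?f, OF der.vector_space_axioms f])
  moreover have "der_mult 1 (sl_der a) = sl_der a"
    by (rule der_eqI) simp
  ultimately show "a = 0"
    by (auto intro: sl_eqI simp: zero_sl.rep_eq)
qed (simp add: tensor_zero_right)

lemma ptens_singleton_eq_0_iff:
  fixes v :: "('n::finite, 'k::field) tpoly"
  shows "ptens [v] = 0 \<longleftrightarrow> v = 0"
proof
  \<comment> \<open>The projection onto the first tensor power. It is multilinear because changing
    one entry preserves the length of the list.\<close>
  let ?g = "\<lambda>vs. (case vs of [w] \<Rightarrow> w | _ \<Rightarrow> 0) :: ('n, 'k) tpoly"
  have g: "?g (us @ (x + y) # vs) = ?g (us @ x # vs) + ?g (us @ y # vs)"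
    "?g (us @ tscale c x # vs) = tscale c (?g (us @ x # vs))" for us vs x y c
    by (auto split: list.splits simp: append_eq_Cons_conv Cons_eq_append_conv)
  note lift = linear_tpow_lift[of tscale ?g, OF tpoly.vector_space_axioms g]
    tpow_lift_ptens[of tscale ?g, OF tpoly.vector_space_axioms g]
  assume "ptens [v] = 0"
  then have "tpow_lift tscale ?g (ptens [v]) = tpow_lift tscale ?g 0"
    by simp
  also have "\<dots> = 0"
    by (rule module_hom.zero[OF Vector_Spaces.linear.axioms(3)[OF lift(1)]])
  finally show "v = 0"
    by (simp add: lift(2))
next
  show "ptens [v] = 0" if "v = 0"
    using that ptens_add[of "[]" 0 0 "[]"] by simp
qed

lemma der_partial_nonzero: "der_partial i \<noteq> 0"
  by (metis der_apply_zero_der der_partial_var zero_neq_one)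

lemma tvar_nonzero: "tvar i \<noteq> 0"
  by (metis der_apply_0 der_partial_var zero_neq_one)

lemma zero_in_act_kernel:
  assumes "Vector_Spaces.linear sl_scale semi_scale \<psi>"
  shows "0 \<in> act_kernel \<psi> m"
proof -
  have "act_pure \<psi> vs 0 = 0" for vs
    using act_pure_add_sl[OF assms, of vs 0 0] by simp
  then have "tpow_act \<psi> 0 t = 0" for t
    by (simp add: tpow_act_def tpow_lift_def free_lift_def)
  then show ?thesis
    by (simp add: act_kernel_def)
qed

text \<open>On the first tensor power, a acts as the derivation \<open>sl_der a\<close> itself, so
  an element acting as zero is zero.\<close>

lemma act_kernel_1_subset:
  assumes "Vector_Spaces.linear sl_scale semi_scale \<psi>" "\<And>a. snd (\<psi> a) = sl_der a"
  shows "act_kernel \<psi> 1 \<subseteq> {0}"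
proof
  fix a assume a: "a \<in> act_kernel \<psi> 1"
  have "der_apply (sl_der a) v = 0" for v
  proof -
    have "ptens [v] \<in> tensor_power 1"
      unfolding tensor_power_def by (rule tpow.span_base) auto
    then have "tpow_act \<psi> a (ptens [v]) = 0"
      using a by (simp add: act_kernel_def)
    then show ?thesis
      by (simp add: tpow_act_ptens[OF assms(1)] assms(2) ptens_singleton_eq_0_iff)
  qed
  then show "a \<in> {0}"
    by (auto intro!: sl_eqI der_eqI simp: zero_sl.rep_eq)
qed

lemma faithful_self_similar_jet_embedding:
  assumes "\<not> CHAR('k::field) dvd CARD('n::finite) + 1"
  shows "faithful_self_similar (jet_embedding :: ('n, 'k) sl \<Rightarrow> ('n, 'k) semi)"
proof -
  let ?\<psi> = "jet_embedding :: ('n, 'k) sl \<Rightarrow> ('n, 'k) semi"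
  \<comment> \<open>Types are nonempty, so an index exists; this is $n \<ge> 1$.\<close>
  fix i :: 'n
  have "snd (?\<psi> (sl_E (Some i) None)) \<noteq> 0"
    by (simp add: jet_embedding_def sl_E.rep_eq der_partial_nonzero)
  then have "\<not> range ?\<psi> \<subseteq> UNIV \<times> {0}"
    by (metis mem_Times_iff rangeI singletonD subsetD)
  \<comment> \<open>This derivation sends \<open>tvar i\<close> to \<open>- tvar i\<close>, which is
    nonzero; its image then has the nonzero first component
    \<open>1 \<otimes> sl_E (Some i) (Some i)\<close>.\<close>
  moreover have "sl_E (Some i) (Some i) \<noteq> (0 :: ('n, 'k) sl)"
    by (metis der_E_apply_simps(1) der_apply_zero_der neg_equal_0_iff_equal sl_E.rep_eq tvar_nonzero zero_sl.rep_eq)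
  then have "fst (?\<psi> (sl_E (Some i) (Some i))) \<noteq> 0"
    by (simp add: jet_embedding_def sl_E.rep_eq jet_linear one_tensor_eq_0_iff del: der_E.simps)
  then have "\<not> range ?\<psi> \<subseteq> {0} \<times> UNIV"
    by (metis mem_Times_iff rangeI singletonD subsetD)
  moreover have "(\<Inter>m\<in>{1..}. act_kernel ?\<psi> m) = {0}"
  proof
    show "(\<Inter>m\<in>{1..}. act_kernel ?\<psi> m) \<subseteq> {0}"
      using act_kernel_1_subset[OF linear_jet_embedding] by (auto simp: jet_embedding_def)
  qed (auto intro: zero_in_act_kernel[OF linear_jet_embedding])
  ultimately show ?thesis
    using lie_algebra_hom_jet_embedding[OF assms] inj_jet_embedding
    by (simp add: faithful_self_similar_def self_similar_def)
qed

theorem theoremC: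
  assumes "\<not> CHAR('k::field) dvd CARD('n::finite) + 1"
  shows "(\<forall>i j. (sl_b i j :: ('n, 'k) sl) =
      sl_E (Some j) (Some i) + (if i = j then \<Sum>l\<in>UNIV. sl_E (Some l) (Some l) else 0)) \<and>
    (\<exists>\<psi> :: ('n, 'k) sl \<Rightarrow> ('n, 'k) semi.
      lie_algebra_hom sl_scale sl_bracket semi_scale semi_bracket \<psi> \<and>
      inj \<psi> \<and>
      (\<forall>i. \<psi> (sl_E (Some i) None) = (0, der_partial i)) \<and>
      (\<forall>i j. \<psi> (sl_E (Some i) (Some j)) =
        (1 \<otimes> sl_E (Some i) (Some j), der_E (Some i) (Some j))) \<and>
      (\<forall>i. \<psi> (sl_E None (Some i)) =
        ((\<Sum>j\<in>UNIV. tvar j \<otimes> sl_b i j) + 1 \<otimes> sl_E None (Some i), der_E None (Some i))) \<and>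
      faithful_self_similar \<psi>)"
proof (intro conjI allI exI)
  show "(sl_b i j :: ('n, 'k) sl) =
      sl_E (Some j) (Some i) + (if i = j then \<Sum>l\<in>UNIV. sl_E (Some l) (Some l) else 0)" for i j
    by (simp add: sl_b_def sl_E_None_None)
  show "lie_algebra_hom sl_scale sl_bracket semi_scale semi_bracket
      (jet_embedding :: ('n, 'k) sl \<Rightarrow> ('n, 'k) semi)"
    by (rule lie_algebra_hom_jet_embedding[OF assms])
  show "inj jet_embedding"
    by (rule inj_jet_embedding)
  show "jet_embedding (sl_E (Some i) None) = (0, der_partial i)" for i
    \<comment> \<open>The goal names \<open>der_partial i\<close>, so \<open>der_E.simps\<close>
      stays active here and the lemma is unfolded to match.\<close>
    by (simp add: jet_embedding_def sl_E.rep_eq jet_partial[unfolded der_E.simps])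
  show "jet_embedding (sl_E (Some i) (Some j)) =
      (1 \<otimes> sl_E (Some i) (Some j), der_E (Some i) (Some j))" for i j
    by (simp add: jet_embedding_def sl_E.rep_eq jet_linear del: der_E.simps)
  show "jet_embedding (sl_E None (Some i) :: ('n, 'k) sl) =
      ((\<Sum>j\<in>UNIV. tvar j \<otimes> sl_b i j) + 1 \<otimes> sl_E None (Some i), der_E None (Some i))" for i
    by (simp add: jet_embedding_def sl_E.rep_eq jet_quadratic[OF assms] del: der_E.simps)
  show "faithful_self_similar (jet_embedding :: ('n, 'k) sl \<Rightarrow> ('n, 'k) semi)"
    by (rule faithful_self_similar_jet_embedding[OF assms])
qed

end
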